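(* Let $\beta\in k^\times$, $X^*=\beta\cdot\sqrt\varpi\in\mathfrak t_\varpi^*$, and let $s,\theta'\in k^\times$, $Y=s\cdot\sqrt{\theta'}\in\mathfrak t_{\theta'}$. If $\operatorname{depth}(X^* )+\operatorname{depth}(Y)<0$ and $X^*$ and $Y$ lie in a common (ramified) torus $\mathbf T$ (with $T=\mathbf T(k)$), then $$M^G_{X^*}(Y)=q^{-(h+1)}|D_{\mathfrak g}(Y)|^{-1/2}\,\gamma_\Phi(X^*,Y)\sum_{\sigma\in W(G,T)}\Phi(\langle\mathrm{Ad}^*(\sigma)X^*,Y\rangle).$$
   Context: $k$ is a non-discrete non-Archimedean local field of residual characteristic $\ne 2$, with ring of integers $\mathcal O$, maximal ideal $\mathfrak p$, valuation $\operatorname{ord}$ with value group $\mathbb Z$, residue field of order $q$, $|x|=q^{-\operatorname{ord}(x)}$; $\varpi$ is a uniformiser. $dx$ (or $dt$) is the Haar measure on $k$ giving $\mathcal O$ measure $1$, and $d^\times x=|x|^{-1}dx$. $\Phi$ is a non-trivial additive character of $k$; $\Phi_b(x)=\Phi(bx)$; the depth of a non-trivial additive character $\Psi$ is $\min\{i\in\mathbb Z:\Psi$ trivial on $\mathfrak p^{i+1}\}$. $k_\varpi=k(\sqrt\varpi)$, $N_\varpi(a+b\sqrt\varpi)=a^2-b^2\varpi$, and $\operatorname{sgn}_\varpi$ is the quadratic character of $k^\times$ with kernel $N_\varpi(k_\varpi^\times)$. $G=\mathrm{SL}_2(k)$, $\mathfrak g=\mathfrak{sl}_2(k)$ with dual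 $\mathfrak g^*$ and pairing $\langle\cdot,\cdot\rangle$. For $\theta\in k^\times$, $\mathbf T_\theta=\{\begin{pmatrix}a&b\\ b\theta&a\end{pmatrix}:a^2-b^2\theta=1\}$, with Lie algebra $\mathfrak t_\theta=k\cdot\sqrt\theta$, where here $\sqrt\theta$ denotes the matrix $\begin{pmatrix}0&1\\ \theta&0\end{pmatrix}$. $X^*=\beta\sqrt\varpi$ means the functional $Z\mapsto\mathrm{Tr}(\beta\sqrt\varpi Z)$ on $\mathfrak g$. $X^*$ and $Y$ lie in a common torus if their centralisers $\mathbf T_\varpi$ and $\mathbf T_{\theta'}$ are equal. $W(G,T)=N_G(T)/T$. $D_{\mathfrak g}\begin{pmatrix}a&b\\c&-a\end{pmatrix}=4(a^2+bc)$. Depth: $\operatorname{depth}(c\sqrt\theta)=\tfrac12\operatorname{ord}(c^2\theta)$ for $c\sqrt\theta\in\mathfrak t_\theta$; $\operatorname{depth}(X^* )$ is the largest real $\rho$ such that $\Phi(\langle X^*,Z\rangle)=1$ for all $Z\in\mathfrak t_\varpi$ with $\operatorname{depth}(Z)>-\rho$. Put $r=-\operatorname{depth}(X^* )$, $\Phi'=\Phi_\beta$ and $h=r+\tfrac12=\operatorname{depth}(\Phi')\in\mathbb Z$. For $\theta'=\varpi$, $\gamma_\Phi(X^*,Y)=\operatorname{sgn}_\varpi(-s)\,G_\varpi(\Phi')$, where $G_\varpi(\Psi)=q^{-1/2}\sum_{X\in\mathcal O/\mathfrak p}\Psi((-\varpi)^{\operatorname{depth}(\Psi)}X^2)$. Mock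 Fourier transform: $$M^G_{X^*}(Y)=\sum_{n\in\mathbb Z}\int_{\operatorname{ord}(x)=n}\mathbf 1_{N_\varpi(k_\varpi^\times)}(x)\Bigl(\sum_{l\in\mathbb Z}\int_{\operatorname{ord}(t)=l}\Phi\bigl(\beta s(x\theta'+x^{-1}\varpi-x^{-1}t^2)\bigr)\,dt\Bigr)d^\times x,$$ where $\mathbf 1_S$ is the characteristic function of $S$. *)

theory Defs
  imports "HOL-Analysis.Analysis" "HOL-Algebra.Group_Action"
begin

section \<open>Non-Archimedean local fields\<close>

text \<open>Valuations take values in \<^typ>\<open>int\<close>; the value \<open>v 0\<close> is irrelevant throughout, and
  every formula using \<open>v\<close> treats \<open>0\<close> (of valuation \<open>\<infinity>\<close>) separately.\<close>

text \<open>\<open>frac_ideal v i\<close> is the fractional ideal \<open>\<pp>\<^sup>i\<close>; in particular \<open>\<O> = \<pp>\<^sup>0\<close> and \<open>\<pp> = \<pp>\<^sup>1\<close>.\<close>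

definition frac_ideal :: "('k::field \<Rightarrow> int) \<Rightarrow> int \<Rightarrow> 'k set" where
  "frac_ideal v i = {x. x = 0 \<or> i \<le> v x}"

definition residue_classes :: "('k::field \<Rightarrow> int) \<Rightarrow> 'k set set" where
  "residue_classes v =
     frac_ideal v 0 // {(x, y). x \<in> frac_ideal v 0 \<and> y \<in> frac_ideal v 0 \<and> x - y \<in> frac_ideal v 1}"

definition residue_card :: "('k::field \<Rightarrow> int) \<Rightarrow> nat" where
  "residue_card v = card (residue_classes v)"

definition abs_val :: "('k::field \<Rightarrow> int) \<Rightarrow> 'k \<Rightarrow> real" where
  "abs_val v x = (if x = 0 then 0 else real (residue_card v) powr (- real_of_int (v x)))"

text \<open>The metric of the type is required to be the one given by the normalised absolute value, so
  that the library notions of completeness, continuity and Borel set are those of the local field.\<close>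

locale nonarch_local_field =
  fixes v :: "'k::{field, complete_space} \<Rightarrow> int"
  assumes v_mult: "x \<noteq> 0 \<Longrightarrow> y \<noteq> 0 \<Longrightarrow> v (x * y) = v x + v y"
    and v_add: "x \<noteq> 0 \<Longrightarrow> y \<noteq> 0 \<Longrightarrow> x + y \<noteq> 0 \<Longrightarrow> min (v x) (v y) \<le> v (x + y)"
    and v_surj: "v ` {x. x \<noteq> 0} = UNIV"
    and finite_residue_field: "finite (residue_classes v)"
    and dist_eq: "dist x y = abs_val v (x - y)"

definition odd_residue_char :: "('k::field \<Rightarrow> int) \<Rightarrow> bool" where
  "odd_residue_char v \<longleftrightarrow> (2::'k) \<notin> frac_ideal v 1"

definition uniformiser :: "('k::field \<Rightarrow> int) \<Rightarrow> 'k \<Rightarrow> bool" where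
  "uniformiser v \<pi> \<longleftrightarrow> \<pi> \<noteq> 0 \<and> v \<pi> = 1"

definition haar :: "('k::{field, complete_space} \<Rightarrow> int) \<Rightarrow> 'k measure \<Rightarrow> bool" where
  "haar v \<mu> \<longleftrightarrow> sets \<mu> = sets borel
     \<and> (\<forall>a. \<forall>A \<in> sets borel. emeasure \<mu> ((+) a ` A) = emeasure \<mu> A)
     \<and> emeasure \<mu> (frac_ideal v 0) = 1"

definition mult_haar :: "('k::field \<Rightarrow> int) \<Rightarrow> 'k measure \<Rightarrow> 'k measure" where
  "mult_haar v \<mu> = density \<mu> (\<lambda>x. ennreal (inverse (abs_val v x)))"

definition additive_character :: "('k::{field, complete_space} \<Rightarrow> complex) \<Rightarrow> bool" where
  "additive_character \<Phi> \<longleftrightarrow>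
     (\<forall>x y. \<Phi> (x + y) = \<Phi> x * \<Phi> y) \<and> (\<forall>x. cmod (\<Phi> x) = 1) \<and> continuous_on UNIV \<Phi>"

definition nontrivial_character :: "('k \<Rightarrow> complex) \<Rightarrow> bool" where
  "nontrivial_character \<Phi> \<longleftrightarrow> (\<exists>x. \<Phi> x \<noteq> 1)"

definition char_depth :: "('k::field \<Rightarrow> int) \<Rightarrow> ('k \<Rightarrow> complex) \<Rightarrow> int" where
  "char_depth v \<Psi> = (LEAST i. \<forall>x \<in> frac_ideal v (i + 1). \<Psi> x = 1)"

definition twist :: "('k::field \<Rightarrow> complex) \<Rightarrow> 'k \<Rightarrow> 'k \<Rightarrow> complex" where
  "twist \<Phi> b = (\<lambda>x. \<Phi> (b * x))"

section \<open>The ramified quadratic extension\<close>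

text \<open>For a non-square \<open>\<pi>\<close>, a pair \<open>(a, b)\<close> stands for the element \<open>a + b\<surd>\<pi>\<close> of \<open>k(\<surd>\<pi>)\<close>, so the
  non-zero elements are the pairs other than \<open>(0, 0)\<close>.\<close>

definition quad_norm :: "'k::field \<Rightarrow> 'k \<times> 'k \<Rightarrow> 'k" where
  "quad_norm \<pi> = (\<lambda>(a, b). a\<^sup>2 - b\<^sup>2 * \<pi>)"

definition norm_group :: "'k::field \<Rightarrow> 'k set" where
  "norm_group \<pi> = quad_norm \<pi> ` (UNIV - {(0, 0)})"

text \<open>Used only at non-zero arguments.\<close>

definition quad_sgn :: "'k::field \<Rightarrow> 'k \<Rightarrow> complex" where
  "quad_sgn \<pi> x = (if x \<in> norm_group \<pi> then 1 else - 1)"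

text \<open>The summand depends only on the class of the chosen representative, because \<open>\<Psi>\<close> is trivial on
  \<open>\<pp>\<^sup>d\<^sup>+\<^sup>1\<close> when \<open>d\<close> is its depth.\<close>

definition gauss_sum :: "('k::field \<Rightarrow> int) \<Rightarrow> 'k \<Rightarrow> ('k \<Rightarrow> complex) \<Rightarrow> complex" where
  "gauss_sum v \<pi> \<Psi> = complex_of_real (real (residue_card v) powr (- 1 / 2)) *
     (\<Sum>C \<in> residue_classes v. \<Psi> ((- \<pi>) powi char_depth v \<Psi> * (SOME x. x \<in> C)\<^sup>2))"

section \<open>The group, its tori and the (dual) Lie algebra\<close>

definition SL2 :: "('k::field ^ 2 ^ 2) monoid" where
  "SL2 = \<lparr>carrier = {g. det g = 1}, mult = (**), one = mat 1\<rparr>"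

definition torus :: "'k::field \<Rightarrow> ('k ^ 2 ^ 2) set" where
  "torus \<theta> = {vector [vector [a, b], vector [b * \<theta>, a]] | a b. a\<^sup>2 - b\<^sup>2 * \<theta> = 1}"

text \<open>\<open>torus_lie \<theta> c\<close> is the element \<open>c\<surd>\<theta>\<close> of the Lie algebra \<open>\<tt>\<^sub>\<theta>\<close>.\<close>

definition torus_lie :: "'k::field \<Rightarrow> 'k \<Rightarrow> 'k ^ 2 ^ 2" where
  "torus_lie \<theta> c = vector [vector [0, c], vector [c * \<theta>, 0]]"

definition weyl_group :: "('k::field ^ 2 ^ 2) monoid \<Rightarrow> ('k ^ 2 ^ 2) set \<Rightarrow> ('k ^ 2 ^ 2) set set" where
  "weyl_group G T = carrier (G\<lparr>carrier := normalizer G T\<rparr> Mod T)"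

text \<open>A functional on \<open>\<ss>\<ll>\<^sub>2\<close> is represented by a function on all matrices, of which only the
  values at trace-zero matrices are used.\<close>

definition trace_functional :: "'k::field ^ 2 ^ 2 \<Rightarrow> 'k ^ 2 ^ 2 \<Rightarrow> 'k" where
  "trace_functional A = (\<lambda>Z. trace (A ** Z))"

definition coadjoint :: "'k::field ^ 2 ^ 2 \<Rightarrow> ('k ^ 2 ^ 2 \<Rightarrow> 'k) \<Rightarrow> 'k ^ 2 ^ 2 \<Rightarrow> 'k" where
  "coadjoint g X = (\<lambda>Z. X (inv\<^bsub>SL2\<^esub> g ** Z ** g))"

definition lie_disc :: "'k::field ^ 2 ^ 2 \<Rightarrow> 'k" where
  "lie_disc Z = 4 * ((Z $ 1 $ 1)\<^sup>2 + Z $ 1 $ 2 * Z $ 2 $ 1)"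

text \<open>Depth of \<open>c\<surd>\<theta>\<close>, for \<open>c, \<theta> \<noteq> 0\<close>.\<close>

definition lie_depth :: "('k::field \<Rightarrow> int) \<Rightarrow> 'k \<Rightarrow> 'k \<Rightarrow> real" where
  "lie_depth v \<theta> c = real_of_int (v (c\<^sup>2 * \<theta>)) / 2"

text \<open>Depth of a functional \<open>X\<close> relative to the torus with parameter \<open>\<theta>\<close>. The disjunct \<open>c = 0\<close>
  expresses that \<open>0 \<in> \<tt>\<^sub>\<theta>\<close> has depth \<open>\<infinity>\<close>.\<close>

definition dual_depth ::
  "('k::field \<Rightarrow> int) \<Rightarrow> ('k \<Rightarrow> complex) \<Rightarrow> 'k \<Rightarrow> ('k ^ 2 ^ 2 \<Rightarrow> 'k) \<Rightarrow> real" where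
  "dual_depth v \<Phi> \<theta> X =
     (GREATEST \<rho>. \<forall>c. c = 0 \<or> lie_depth v \<theta> c > - \<rho> \<longrightarrow> \<Phi> (X (torus_lie \<theta> c)) = 1)"

text \<open>\<open>\<gamma>\<^sub>\<Phi>(X\<^sup>*, Y)\<close> for \<open>X\<^sup>* = \<beta>\<surd>\<pi>\<close> and \<open>Y = s\<surd>\<pi>\<close>, i.e. in the case where \<open>X\<^sup>*\<close> and \<open>Y\<close> lie in a
  common torus.\<close>

definition gamma_factor ::
  "('k::field \<Rightarrow> int) \<Rightarrow> ('k \<Rightarrow> complex) \<Rightarrow> 'k \<Rightarrow> 'k \<Rightarrow> 'k \<Rightarrow> complex" where
  "gamma_factor v \<Phi> \<pi> \<beta> s = quad_sgn \<pi> (- s) * gauss_sum v \<pi> (twist \<Phi> \<beta>)"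

text \<open>The mock Fourier transform at \<open>X\<^sup>* = \<beta>\<surd>\<pi>\<close> and \<open>Y = s\<surd>\<theta>'\<close>.\<close>

definition shell :: "('k::field \<Rightarrow> int) \<Rightarrow> int \<Rightarrow> 'k set" where
  "shell v n = {x. x \<noteq> 0 \<and> v x = n}"

definition mock_fourier ::
  "('k::{field, complete_space} \<Rightarrow> int) \<Rightarrow> 'k measure \<Rightarrow> ('k \<Rightarrow> complex) \<Rightarrow> 'k
     \<Rightarrow> 'k \<Rightarrow> 'k \<Rightarrow> 'k \<Rightarrow> complex" where
  "mock_fourier v \<mu> \<Phi> \<pi> \<beta> s \<theta>' =
     (\<Sum>\<^sub>\<infinity>n. LINT x:shell v n|mult_haar v \<mu>.
        indicator (norm_group \<pi>) x *
        (\<Sum>\<^sub>\<infinity>l. LINT t:shell v l|\<mu>.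
           \<Phi> (\<beta> * s * (x * \<theta>' + inverse x * \<pi> - inverse x * t\<^sup>2))))"

end

theory Submission
  imports Defs
begin

text \<open>The two tori coincide only if \<open>\<theta>' = \<pi>\<close>. Write \<open>\<psi> = \<Phi>\<^sub>\<beta>\<close>, of depth \<open>d = h\<close>. The inner sum is
  \<open>\<psi> (s\<pi>(x + 1/x)) J(-s/x)\<close> with a Fresnel integral \<open>J c = \<integral> \<psi> (c t\<^sup>2) dt\<close>: shells of small valuation
  contribute nothing, and on shells of large valuation \<open>\<psi>\<close> is trivial. Norms have the form
  \<open>(-\<pi>)\<^sup>n z\<^sup>2\<close>, so \<open>J(-s/x)\<close> is constant on the norms of a given valuation. The phase \<open>x + 1/x\<close>
  has stationary points \<open>\<plusminus>1\<close> only; away from them the integral over \<open>x\<close> vanishes, and near \<open>\<plusminus>1\<close> the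
  phase is quadratic, which gives \<open>J(-s) J(s\<pi>) (\<psi> (2s\<pi>) + [-1 is a norm] \<psi> (-2s\<pi>))\<close>. Exactly one of
  the two Fresnel integrals is a quadratic Gauss sum, the other one is a volume. The bracket is the
  sum over the Weyl group, because the non-trivial Weyl element exists iff \<open>-1\<close> is a norm.\<close>

section \<open>Valuations, residues and additive characters\<close>

text \<open>Since \<open>\<psi> (c * t^2)\<close> has modulus 1 and \<open>k\<close> has infinite
  volume, the Fresnel integral exists only as a sum over shells, and the vanishing has to be proved
  shell by shell. All of it comes from \<open>integral_eq_0_if_oscillating\<close>: a shift by
  \<open>y\<close> in \<open>P k\<close> multiplies the integrand by
  \<open>\<psi> (c x * y)\<close>, where \<open>c x\<close> is the derivative of the phase. So
  \<open>k\<close> is always \<open>d\<close> minus the valuation of the derivative, and what must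
  be checked is that the second-order remainder falls into \<open>P (d + 1)\<close>. The depth
  hypothesis amounts to \<open>v s + 1 < d\<close>, that is \<open>v (s * \<pi>) < d\<close>; this
  is what makes the phase oscillate away from 1 and -1. The two Fresnel arguments have valuations of
  opposite parity, and \<open>s * \<pi> = (- s) * (- \<pi>)\<close> differs from \<open>- s\<close>
  by the norm \<open>- \<pi>\<close> of the square root of \<open>\<pi>\<close>; hence the sign is
  that of \<open>- s\<close> whichever of the two is the Gauss sum. The power of q is
  \<open>v s - d - 1 = - (d + 1) + (v s + 1/2) - 1/2\<close>: the middle term is the discriminant
  \<open>4 * s^2 * \<pi>\<close>, the last one the normalisation of the Gauss sum.\<close>

lemma int_has_least:
  fixes Q :: "int \<Rightarrow> bool"
  assumes "Q i0" and lb: "\<And>i. Q i \<Longrightarrow> lb \<le> i"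
  shows "\<exists>m. Q m \<and> (\<forall>i. Q i \<longrightarrow> m \<le> i)"
proof -
  \<comment> \<open>Shifting by the lower bound \<open>lb\<close> transports the question to the
    well-ordered naturals.\<close>
  obtain m where m: "Q m" "\<And>i. Q i \<Longrightarrow> nat (m - lb) \<le> nat (i - lb)"
    using ex_has_least_nat[of Q i0 "\<lambda>i. nat (i - lb)"] assms(1) by blast
  have "m \<le> i" if "Q i" for i
    using m(2)[OF that] lb[OF that] lb[OF m(1)] by linarith
  then show ?thesis using m(1) by blast
qed

context nonarch_local_field
begin

abbreviation P :: "int \<Rightarrow> 'k set" where "P \<equiv> frac_ideal v"
abbreviation qr :: real where "qr \<equiv> real (residue_card v)"

section \<open>Ultrametric arithmetic of the fractional ideals\<close>

lemma v_one [simp]: "v 1 = 0"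
  using v_mult[of 1 1] by simp

lemma v_minus_one [simp]: "v (- 1) = 0"
  using v_mult[of "-1" "-1"] by simp

lemma v_minus [simp]: "v (- x) = v x"
proof (cases "x = 0")
  case False
  then show ?thesis using v_mult[of "-1" x] by simp
qed simp

lemma v_inverse: "x \<noteq> 0 \<Longrightarrow> v (inverse x) = - v x"
  using v_mult[of x "inverse x"] by simp

lemma v_divide: "x \<noteq> 0 \<Longrightarrow> y \<noteq> 0 \<Longrightarrow> v (x / y) = v x - v y"
  by (simp add: divide_inverse v_mult v_inverse)

lemma v_power: "x \<noteq> 0 \<Longrightarrow> v (x ^ n) = int n * v x"
  by (induction n) (auto simp: v_mult algebra_simps)

lemma v_powi: "x \<noteq> 0 \<Longrightarrow> v (x powi n) = n * v x"
  by (cases "n \<ge> 0") (auto simp: power_int_def v_power v_inverse power_inverse)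

lemma P_0 [simp]: "0 \<in> P i"
  by (simp add: frac_ideal_def)

lemma P_iff: "x \<noteq> 0 \<Longrightarrow> x \<in> P i \<longleftrightarrow> i \<le> v x"
  by (simp add: frac_ideal_def)

lemma P_mono: "x \<in> P j \<Longrightarrow> i \<le> j \<Longrightarrow> x \<in> P i"
  by (auto simp: frac_ideal_def)

lemma P_add: "x \<in> P i \<Longrightarrow> y \<in> P i \<Longrightarrow> x + y \<in> P i"
  using v_add[of x y] by (fastforce simp: frac_ideal_def)

lemma P_minus [simp]: "- x \<in> P i \<longleftrightarrow> x \<in> P i"
  by (simp add: frac_ideal_def)

lemma P_diff: "x \<in> P i \<Longrightarrow> y \<in> P i \<Longrightarrow> x - y \<in> P i"
  using P_add[of x i "- y"] by simp

lemma P_diff_commute: "x - y \<in> P i \<longleftrightarrow> y - x \<in> P i"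
  using P_minus[of "x - y" i] by simp

lemma P_mult: "x \<in> P i \<Longrightarrow> y \<in> P j \<Longrightarrow> x * y \<in> P (i + j)"
  by (cases "x = 0 \<or> y = 0") (auto simp: frac_ideal_def v_mult)

lemma P_mult_iff: "c \<noteq> 0 \<Longrightarrow> c * x \<in> P i \<longleftrightarrow> x \<in> P (i - v c)"
  by (cases "x = 0") (auto simp: frac_ideal_def v_mult)

lemma P_divide_iff: "c \<noteq> 0 \<Longrightarrow> x / c \<in> P i \<longleftrightarrow> x \<in> P (i + v c)"
  by (cases "x = 0") (auto simp: frac_ideal_def v_divide)

lemma P_1: "1 \<in> P 0" "1 \<notin> P 1"
  by (auto simp: frac_ideal_def)

lemma P_power2: "x \<in> P i \<Longrightarrow> x\<^sup>2 \<in> P (2 * i)"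
  using P_mult[of x i x i] by (simp add: power2_eq_square)

lemma P_power2_diff: "x \<in> P 0 \<Longrightarrow> y \<in> P 0 \<Longrightarrow> x - y \<in> P i \<Longrightarrow> x\<^sup>2 - y\<^sup>2 \<in> P i"
  using P_mult[of "x + y" 0 "x - y" i] P_add[of x 0 y]
  by (simp add: power2_eq_square algebra_simps)

lemma unit_mult_P_iff: "w \<noteq> 0 \<Longrightarrow> v w = 0 \<Longrightarrow> w * x \<in> P i \<longleftrightarrow> x \<in> P i"
  by (simp add: P_mult_iff)

text \<open>A summand of larger valuation cannot cancel the leading term: if it raised the
  valuation, subtracting \<open>y\<close> again would put \<open>x\<close> into
  \<open>P (v x + 1)\<close>.\<close>

lemma v_add_eq: "x \<noteq> 0 \<Longrightarrow> y \<in> P (v x + 1) \<Longrightarrow> x + y \<noteq> 0 \<and> v (x + y) = v x"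
proof -
  assume x: "x \<noteq> 0" and y: "y \<in> P (v x + 1)"
  have 1: "x + y \<noteq> 0"
  proof
    assume "x + y = 0"
    then have "y = - x" by (simp add: add_eq_0_iff)
    with y x show False by (simp add: P_iff)
  qed
  have "x \<in> P (v x)" using x by (simp add: P_iff)
  then have "x + y \<in> P (v x)" using y P_add P_mono[of y "v x + 1" "v x"] by simp
  then have "v x \<le> v (x + y)" using 1 by (simp add: P_iff)
  moreover have "\<not> v x + 1 \<le> v (x + y)"
  proof
    assume "v x + 1 \<le> v (x + y)"
    then have "x + y \<in> P (v x + 1)" using 1 by (simp add: P_iff)
    then have "x + y - y \<in> P (v x + 1)" using y by (rule P_diff)
    then show False using x by (simp add: P_iff)
  qed
  ultimately show ?thesis using 1 by simp
qed

lemma square_diff_P: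
  assumes "x \<in> P 0" "y \<in> P k" "0 \<le> k"
  shows "(x + y)\<^sup>2 - x\<^sup>2 \<in> P k"
proof -
  have "x + x + y \<in> P 0" by (intro P_add assms(1) P_mono[OF assms(2,3)])
  then have "y * (x + x + y) \<in> P (k + 0)" using assms by (intro P_mult)
  then show ?thesis by (simp add: power2_eq_square algebra_simps)
qed

section \<open>Residue classes and sums over their representatives\<close>

text \<open>The representatives are those picked by \<^const>\<open>gauss_sum\<close>.\<close>

definition rep :: "'k set" where "rep = (\<lambda>C. SOME x. x \<in> C) ` residue_classes v"

definition res_rel :: "('k \<times> 'k) set" where
  "res_rel = {(x, y). x \<in> P 0 \<and> y \<in> P 0 \<and> x - y \<in> P 1}"

lemma residue_classes_eq: "residue_classes v = P 0 // res_rel"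
  by (simp add: residue_classes_def res_rel_def)

lemma equiv_res_rel: "equiv (P 0) res_rel"
proof (rule equivI)
  show "res_rel \<subseteq> P 0 \<times> P 0" by (auto simp: res_rel_def)
  show "refl_on (P 0) res_rel" by (auto simp: refl_on_def res_rel_def)
  show "sym res_rel" by (auto simp: sym_def res_rel_def P_diff_commute)
  show "trans res_rel"
  proof (rule transI)
    fix x y z assume "(x, y) \<in> res_rel" "(y, z) \<in> res_rel"
    then show "(x, z) \<in> res_rel" using P_add[of "x - y" 1 "y - z"] by (auto simp: res_rel_def)
  qed
qed

lemma some_residue_class:
  assumes "C \<in> residue_classes v"
  shows "(SOME x. x \<in> C) \<in> C"
proof -
  have "C \<noteq> {}" using assms equiv_res_rel in_quotient_imp_non_empty residue_classes_eq by auto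
  then show ?thesis by (simp add: some_in_eq)
qed

lemma inj_on_some: "inj_on (\<lambda>C. SOME x. x \<in> C) (residue_classes v)"
proof (rule inj_onI)
  fix C D assume C: "C \<in> residue_classes v" and D: "D \<in> residue_classes v"
    and eq: "(SOME x. x \<in> C) = (SOME x. x \<in> D)"
  then have "(SOME x. x \<in> C) \<in> C \<inter> D" using some_residue_class by fastforce
  then show "C = D" using C D quotient_disj[OF equiv_res_rel] unfolding residue_classes_eq by blast
qed

lemma finite_rep [simp]: "finite rep"
  using finite_residue_field by (simp add: rep_def)

lemma card_rep: "card rep = residue_card v"
  unfolding rep_def residue_card_def by (rule card_image[OF inj_on_some])

lemma sum_residue_classes: "(\<Sum>C\<in>residue_classes v. f (SOME x. x \<in> C)) = (\<Sum>a\<in>rep. f a)"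
  unfolding rep_def by (simp add: sum.reindex[OF inj_on_some])

lemma rep_P0: "a \<in> rep \<Longrightarrow> a \<in> P 0"
proof -
  assume "a \<in> rep"
  then obtain C where "C \<in> residue_classes v" "a \<in> C" using some_residue_class by (auto simp: rep_def)
  then show ?thesis using in_quotient_imp_subset[OF equiv_res_rel] by (auto simp: residue_classes_eq)
qed

lemma rep_eq: "a \<in> rep \<Longrightarrow> b \<in> rep \<Longrightarrow> a - b \<in> P 1 \<Longrightarrow> a = b"
proof -
  assume a: "a \<in> rep" and b: "b \<in> rep" and ab: "a - b \<in> P 1"
  obtain C where C: "C \<in> residue_classes v" "a = (SOME x. x \<in> C)" using a by (auto simp: rep_def)
  obtain D where D: "D \<in> residue_classes v" "b = (SOME x. x \<in> D)" using b by (auto simp: rep_def)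
  have "a \<in> C" "b \<in> D" using C D some_residue_class by auto
  moreover have "(a, b) \<in> res_rel" using ab rep_P0[OF a] rep_P0[OF b] by (simp add: res_rel_def)
  ultimately have "C = D"
    using quotient_eqI[OF equiv_res_rel] C(1) D(1) unfolding residue_classes_eq by blast
  then show "a = b" using C D by simp
qed

lemma rep_exists: "x \<in> P 0 \<Longrightarrow> \<exists>a\<in>rep. x - a \<in> P 1"
proof -
  assume x: "x \<in> P 0"
  define C where "C = res_rel `` {x}"
  have C: "C \<in> residue_classes v" using x by (simp add: residue_classes_eq C_def quotientI)
  have "(SOME x. x \<in> C) \<in> rep" using C by (simp add: rep_def)
  moreover have "x - (SOME x. x \<in> C) \<in> P 1"
    using some_residue_class[OF C] unfolding C_def res_rel_def by blast
  ultimately show ?thesis by blast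
qed

definition red :: "'k \<Rightarrow> 'k" where "red x = (SOME a. a \<in> rep \<and> x - a \<in> P 1)"

lemma red: "x \<in> P 0 \<Longrightarrow> red x \<in> rep" "x \<in> P 0 \<Longrightarrow> x - red x \<in> P 1"
proof -
  assume "x \<in> P 0"
  then have "\<exists>a. a \<in> rep \<and> x - a \<in> P 1" using rep_exists by blast
  from someI_ex[OF this] show "red x \<in> rep" "x - red x \<in> P 1" by (simp_all add: red_def)
qed

lemma residue_card_ge_2: "2 \<le> residue_card v"
proof -
  have "red 0 \<noteq> red 1"
  proof
    assume eq: "red 0 = red 1"
    have "1 - red 1 - (0 - red 0) \<in> P 1" by (rule P_diff) (simp_all only: red(2) P_1 P_0)
    then show False using eq P_1 by simp
  qed
  then have "card {red 0, red 1} = 2" by simp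
  moreover have "{red 0, red 1} \<subseteq> rep" using red(1) P_1 by auto
  ultimately show ?thesis using card_mono[OF finite_rep] card_rep by metis
qed

lemma qr_gt_1: "1 < qr"
  using residue_card_ge_2 by linarith

text \<open>A map that is injective modulo \<open>P 1\<close> permutes the finitely many residue
  classes. \<open>\<tau> a\<close> need not be one of the chosen representatives, so
  \<open>red\<close> moves it back, which \<open>f\<close> does not notice. This is the change of
  variables for translations and for multiplication by units.\<close>

lemma sum_rep_perm:
  fixes f :: "'k \<Rightarrow> 'a::comm_monoid_add"
  assumes P0: "\<And>x. x \<in> P 0 \<Longrightarrow> \<tau> x \<in> P 0"
    and inj: "\<And>x y. x \<in> P 0 \<Longrightarrow> y \<in> P 0 \<Longrightarrow> \<tau> x - \<tau> y \<in> P 1 \<Longrightarrow> x - y \<in> P 1"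
    and inv: "\<And>x y. x \<in> P 0 \<Longrightarrow> y \<in> P 0 \<Longrightarrow> x - y \<in> P 1 \<Longrightarrow> f x = f y"
  shows "(\<Sum>a\<in>rep. f (\<tau> a)) = (\<Sum>a\<in>rep. f a)"
proof -
  have "inj_on (\<lambda>a. red (\<tau> a)) rep"
  proof (rule inj_onI)
    fix a b assume ab: "a \<in> rep" "b \<in> rep" "red (\<tau> a) = red (\<tau> b)"
    have "\<tau> a - red (\<tau> a) - (\<tau> b - red (\<tau> b)) \<in> P 1"
      by (rule P_diff) (use red(2) P0 rep_P0 ab in blast)+
    then have "\<tau> a - \<tau> b \<in> P 1" using ab by simp
    then show "a = b" using inj rep_P0 ab rep_eq by blast
  qed
  moreover have "(\<lambda>a. red (\<tau> a)) ` rep \<subseteq> rep" using red(1) P0 rep_P0 by blast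
  ultimately have "bij_betw (\<lambda>a. red (\<tau> a)) rep rep"
    by (simp add: bij_betw_def endo_inj_surj)
  then have "(\<Sum>a\<in>rep. f (red (\<tau> a))) = (\<Sum>a\<in>rep. f a)" by (rule sum.reindex_bij_betw)
  moreover have "f (red (\<tau> a)) = f (\<tau> a)" if "a \<in> rep" for a
    using inv[of "\<tau> a" "red (\<tau> a)"] red P0 rep_P0 that by metis
  ultimately show ?thesis by simp
qed

section \<open>Topology of the metric and local triviality of characters\<close>

lemma dist_less_iff: "dist x y < qr powr real_of_int (1 - i) \<longleftrightarrow> x - y \<in> P i"
  using qr_gt_1 by (auto simp: dist_eq abs_val_def frac_ideal_def)

text \<open>Distances are integral powers of q, so \<open>P i\<close> is also the open ball of
  radius \<open>q^(1 - i)\<close>; a union of cosets of \<open>P i\<close> is therefore open. All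
  measurability of the sets and integrands below rests on this.\<close>

lemma open_if_stable: "(\<And>x y. x \<in> A \<Longrightarrow> y \<in> P i \<Longrightarrow> x + y \<in> A) \<Longrightarrow> open A"
proof -
  assume st: "\<And>x y. x \<in> A \<Longrightarrow> y \<in> P i \<Longrightarrow> x + y \<in> A"
  show "open A"
    unfolding open_dist
  proof
    fix x assume x: "x \<in> A"
    have "y \<in> A" if "dist y x < qr powr real_of_int (1 - i)" for y
      using st[OF x, of "y - x"] that dist_less_iff by simp
    then show "\<exists>e>0. \<forall>y. dist y x < e \<longrightarrow> y \<in> A"
      using qr_gt_1 by (intro exI[of _ "qr powr real_of_int (1 - i)"]) simp
  qed
qed

lemma borel_measurable_invariant:
  fixes f :: "'k \<Rightarrow> 'a::topological_space"
  assumes "\<And>x y. y \<in> P i \<Longrightarrow> f (x + y) = f x"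
  shows "f \<in> borel_measurable borel"
  by (rule borel_measurableI, rule borel_open, rule open_if_stable[of _ i]) (use assms in auto)

lemma open_P: "open (P i)"
  by (rule open_if_stable[of _ i]) (rule P_add)

lemma closed_P: "closed (P i)"
  unfolding closed_def
proof (rule open_if_stable[of _ i])
  fix x y assume "x \<in> - P i" "y \<in> P i"
  then show "x + y \<in> - P i" using P_diff[of "x + y" i y] by force
qed

lemma shell_eq: "shell v n = P n - P (n + 1)"
  by (auto simp: shell_def frac_ideal_def)

lemma shell_stable: "x \<in> shell v n \<Longrightarrow> y \<in> P (n + 1) \<Longrightarrow> x + y \<in> shell v n"
  using v_add_eq[of x y] by (auto simp: shell_def)

lemma open_shell: "open (shell v n)"
  by (rule open_if_stable) (rule shell_stable)

lemma continuous_dist: "continuous_on UNIV (\<lambda>x::'k. dist x 0)"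
  by (intro continuous_intros)

lemma abs_val_measurable: "abs_val v \<in> borel_measurable borel"
proof -
  have "abs_val v = (\<lambda>x. dist x 0)" by (simp add: dist_eq fun_eq_iff)
  then show ?thesis using continuous_dist by (simp add: borel_measurable_continuous_onI)
qed

text \<open>The only link between metric and addition is \<open>dist_eq\<close>, which makes
  translations isometries.\<close>

lemma translation_measurable: "(+) (a::'k) \<in> borel_measurable borel"
proof (rule borel_measurable_continuous_onI)
  have "dist (a + x) (a + y) = dist x y" for x y by (simp add: dist_eq)
  then show "continuous_on UNIV ((+) a)"
    unfolding continuous_on_iff by metis
qed

text \<open>The circle has no small subgroups. Where \<open>\<Phi> x\<close> is within 1/2 of 1, the
  factor \<open>\<Phi> x + 1\<close> has modulus at least 3/2, so doubling \<open>x\<close> moves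
  \<open>\<Phi> x\<close> away from 1 by a factor 3/2. As \<open>P i\<close> is closed under
  doubling, a value other than 1 would eventually leave the disc.\<close>

lemma character_trivial_near_0:
  assumes "additive_character \<Phi>"
  shows "\<exists>i. \<forall>x\<in>P i. \<Phi> x = 1"
proof -
  have add: "\<Phi> (x + y) = \<Phi> x * \<Phi> y" and norm: "cmod (\<Phi> x) = 1"
    and cont: "continuous_on UNIV \<Phi>" for x y
    using assms by (auto simp: additive_character_def)
  have "\<Phi> 0 * \<Phi> 0 = \<Phi> 0" using add[of 0 0] by simp
  moreover have "\<Phi> 0 \<noteq> 0" using norm[of 0] by auto
  ultimately have \<Phi>0: "\<Phi> 0 = 1" by simp
  obtain \<delta> where \<delta>: "\<delta> > 0" "\<And>x. dist x 0 < \<delta> \<Longrightarrow> dist (\<Phi> x) (\<Phi> 0) < 1 / 2"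
    using cont unfolding continuous_on_iff by (metis UNIV_I half_gt_zero zero_less_one)
  obtain n where n: "(1 / qr) ^ n < \<delta>" using real_arch_pow_inv[of \<delta> "1 / qr"] \<delta>(1) qr_gt_1 by auto
  \<comment> \<open>The index \<open>int n + 1\<close> is chosen so that its ideal is the ball of
    radius \<open>q^(-n) < \<delta>\<close>.\<close>
  have "qr powr real_of_int (1 - (int n + 1)) = (1 / qr) ^ n"
    using qr_gt_1 by (simp add: powr_minus powr_realpow power_one_over inverse_eq_divide)
  then have small: "cmod (\<Phi> x - 1) < 1 / 2" if "x \<in> P (int n + 1)" for x
    using dist_less_iff[of x 0 "int n + 1"] that n \<delta>(2)[of x] by (simp add: \<Phi>0 dist_norm)
  have growth: "(3 / 2) ^ k * cmod (\<Phi> x - 1) \<le> 1 / 2" if "x \<in> P (int n + 1)" for x k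
    using that
  proof (induction k arbitrary: x)
    case 0
    then show ?case using small by (simp add: less_imp_le)
  next
    case (Suc k)
    have "2 - cmod (\<Phi> x - 1) \<le> cmod (\<Phi> x + 1)"
      using norm_triangle_ineq4[of "\<Phi> x + 1" "\<Phi> x - 1"] by simp
    then have "3 / 2 \<le> cmod (\<Phi> x + 1)" using small[OF Suc.prems] by simp
    then have "3 / 2 * cmod (\<Phi> x - 1) \<le> cmod (\<Phi> x + 1) * cmod (\<Phi> x - 1)" by (rule mult_right_mono) simp
    also have "\<dots> = cmod ((\<Phi> x + 1) * (\<Phi> x - 1))" by (simp only: norm_mult)
    also have "(\<Phi> x + 1) * (\<Phi> x - 1) = \<Phi> (x + x) - 1" unfolding add by (simp add: algebra_simps)
    finally have "(3 / 2) ^ k * (3 / 2 * cmod (\<Phi> x - 1)) \<le> (3 / 2) ^ k * cmod (\<Phi> (x + x) - 1)"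
      by (rule mult_left_mono) simp
    also have "\<dots> \<le> 1 / 2" by (rule Suc.IH) (rule P_add[OF Suc.prems Suc.prems])
    finally show ?case by simp
  qed
  have "\<Phi> x = 1" if "x \<in> P (int n + 1)" for x
  proof (rule ccontr)
    assume "\<Phi> x \<noteq> 1"
    then have pos: "0 < cmod (\<Phi> x - 1)" by simp
    obtain k where "1 / 2 / cmod (\<Phi> x - 1) < (3 / 2) ^ k" using real_arch_pow[of "3 / 2"] by auto
    then show False using growth[OF that, of k] pos by (simp add: field_simps)
  qed
  then show ?thesis by blast
qed

text \<open>\<open>LEAST\<close> on integers means something only once a minimum exists. Triviality
  on some \<open>P i\<close> gives an admissible index, and a point where \<open>\<Psi>\<close> is
  not 1 bounds all admissible indices below by its valuation; minimality is then non-triviality one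
  step further out.\<close>

lemma char_depth_works:
  assumes i: "\<forall>x\<in>P i. \<Psi> x = 1" and \<Psi>: "nontrivial_character \<Psi>"
  shows "x \<in> P (char_depth v \<Psi> + 1) \<Longrightarrow> \<Psi> x = 1" and "\<exists>x\<in>P (char_depth v \<Psi>). \<Psi> x \<noteq> 1"
proof -
  define Q where "Q i \<longleftrightarrow> (\<forall>x\<in>P (i + 1). \<Psi> x = 1)" for i
  have "Q (i - 1)" using i by (simp add: Q_def)
  moreover obtain x0 where x0: "\<Psi> x0 \<noteq> 1" using \<Psi> by (auto simp: nontrivial_character_def)
  then have "x0 \<noteq> 0" using i P_0 by metis
  then have "v x0 \<le> i" if "Q i" for i
    using that x0 P_iff[of x0 "i + 1"] by (force simp: Q_def)
  ultimately obtain m where m: "Q m" "\<And>i. Q i \<Longrightarrow> m \<le> i" using int_has_least by metis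
  then have d: "char_depth v \<Psi> = m"
    unfolding char_depth_def Q_def by (intro Least_equality)
  show "\<Psi> x = 1" if "x \<in> P (char_depth v \<Psi> + 1)" using that m(1) by (simp add: d Q_def)
  have "\<not> Q (m - 1)" using m(2)[of "m - 1"] by auto
  then show "\<exists>x\<in>P (char_depth v \<Psi>). \<Psi> x \<noteq> 1" by (simp add: Q_def d)
qed

end

section \<open>Integration\<close>

locale local_field_haar = nonarch_local_field v for v :: "'k::{field, complete_space} \<Rightarrow> int" +
  fixes \<pi> :: 'k and \<mu> :: "'k measure"
  assumes unif: "uniformiser v \<pi>" and haar: "haar v \<mu>"
begin

lemma pi_nz [simp]: "\<pi> \<noteq> 0" and v_pi [simp]: "v \<pi> = 1"
  using unif by (auto simp: uniformiser_def)

lemma v_pi_powi [simp]: "v (\<pi> powi n) = n"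
  by (simp add: v_powi)

section \<open>Haar measure of the fractional ideals\<close>

lemma sets_mu [measurable_cong, simp]: "sets \<mu> = sets borel"
  using haar by (simp add: haar_def)

lemma space_mu [simp]: "space \<mu> = UNIV"
  using sets_eq_imp_space_eq[OF sets_mu] by simp

lemma measurable_mu [simp]: "borel_measurable \<mu> = borel_measurable borel"
  by (rule measurable_cong_sets) simp_all

lemma P_sets [measurable, simp]: "P i \<in> sets borel"
  using open_P by simp

lemma shell_sets [measurable, simp]: "shell v n \<in> sets borel"
  using open_shell by simp

lemma emeasure_translate: "A \<in> sets borel \<Longrightarrow> emeasure \<mu> ((+) a ` A) = emeasure \<mu> A"
  using haar by (simp add: haar_def)

lemma distr_translate: "distr \<mu> \<mu> ((+) a) = \<mu>"
proof (rule measure_eqI)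
  have m: "(+) a \<in> measurable \<mu> \<mu>"
    using translation_measurable by (simp add: measurable_cong_sets[OF sets_mu sets_mu])
  fix A assume A: "A \<in> sets (distr \<mu> \<mu> ((+) a))"
  \<comment> \<open>\<open>haar\<close> speaks of images while \<open>distr\<close> takes preimages;
    the preimage under translation by \<open>a\<close> is the image under translation by
    \<open>- a\<close>.\<close>
  have vim: "(+) a -` A = (+) (- a) ` A"
    by (auto simp: image_iff algebra_simps intro!: bexI[of _ "a + x" for x])
  have "emeasure \<mu> ((+) a -` A) = emeasure \<mu> A"
    unfolding vim using A by (intro emeasure_translate) simp
  then show "emeasure (distr \<mu> \<mu> ((+) a)) A = emeasure \<mu> A"
    using A m by (simp add: emeasure_distr)
qed simp

lemma integral_translate:
  fixes f :: "'k \<Rightarrow> 'b::{banach, second_countable_topology}"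
  assumes "f \<in> borel_measurable borel"
  shows "(LINT x|\<mu>. f (a + x)) = (LINT x|\<mu>. f x)"
proof -
  have m: "(+) a \<in> measurable \<mu> \<mu>"
    using translation_measurable by (simp add: measurable_cong_sets[OF sets_mu sets_mu])
  show ?thesis
    using integral_distr[OF m, of f] assms by (simp add: distr_translate)
qed

text \<open>Multiplication by \<open>\<pi> powi m\<close> identifies the residue classes with the
  cosets of \<open>P (m + 1)\<close> in \<open>P m\<close>.\<close>

lemma P_decompose: "P m = (\<Union>a\<in>rep. (+) (\<pi> powi m * a) ` P (m + 1))"
proof (intro equalityI subsetI)
  fix x assume x: "x \<in> P m"
  define y where "y = x / \<pi> powi m"
  have xy: "x = \<pi> powi m * y" by (simp add: y_def)
  have "y \<in> P 0" using x by (simp add: xy P_mult_iff)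
  then obtain a where a: "a \<in> rep" "y - a \<in> P 1" using rep_exists by blast
  have "\<pi> powi m * (y - a) \<in> P (m + 1)" using a by (simp add: P_mult_iff)
  moreover have "x = \<pi> powi m * a + \<pi> powi m * (y - a)" by (simp add: xy algebra_simps)
  ultimately show "x \<in> (\<Union>a\<in>rep. (+) (\<pi> powi m * a) ` P (m + 1))" using a(1) by blast
next
  fix x assume "x \<in> (\<Union>a\<in>rep. (+) (\<pi> powi m * a) ` P (m + 1))"
  then obtain a y where ay: "a \<in> rep" "y \<in> P (m + 1)" "x = \<pi> powi m * a + y" by auto
  then show "x \<in> P m" using rep_P0[of a] P_mono[of y "m + 1" m] by (simp add: P_add P_mult_iff)
qed

lemma disjoint_cosets: "disjoint_family_on (\<lambda>a. (+) (\<pi> powi m * a) ` P (m + 1)) rep"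
  unfolding disjoint_family_on_def
proof (intro ballI impI)
  fix a b assume ab: "a \<in> rep" "b \<in> rep" "a \<noteq> b"
  show "(+) (\<pi> powi m * a) ` P (m + 1) \<inter> (+) (\<pi> powi m * b) ` P (m + 1) = {}"
  proof (rule ccontr)
    assume "(+) (\<pi> powi m * a) ` P (m + 1) \<inter> (+) (\<pi> powi m * b) ` P (m + 1) \<noteq> {}"
    then obtain y z where yz: "y \<in> P (m + 1)" "z \<in> P (m + 1)" "\<pi> powi m * a + y = \<pi> powi m * b + z"
      by auto
    then have "\<pi> powi m * (a - b) = z - y" by (simp add: algebra_simps)
    then have "\<pi> powi m * (a - b) \<in> P (m + 1)" using yz P_diff by simp
    then have "a - b \<in> P 1" by (simp add: P_mult_iff)
    then show False using rep_eq ab by blast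
  qed
qed

lemma coset_sets [simp]: "(+) a ` P i \<in> sets borel"
proof -
  have "open ((+) a ` P i)"
  proof (rule open_if_stable[of _ i])
    fix x y assume "x \<in> (+) a ` P i" "y \<in> P i"
    then obtain z where z: "z \<in> P i" "x = a + z" by blast
    have "x + y = a + (z + y)" using z by (simp add: add.assoc)
    then show "x + y \<in> (+) a ` P i" using P_add[OF z(1) \<open>y \<in> P i\<close>] by blast
  qed
  then show ?thesis by simp
qed

lemma emeasure_P_step: "emeasure \<mu> (P m) = of_nat (residue_card v) * emeasure \<mu> (P (m + 1))"
proof -
  have "emeasure \<mu> (P m) = (\<Sum>a\<in>rep. emeasure \<mu> ((+) (\<pi> powi m * a) ` P (m + 1)))"
    unfolding P_decompose[of m]
    by (rule sum_emeasure[symmetric]) (auto simp: disjoint_cosets)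
  also have "\<dots> = (\<Sum>a\<in>rep. emeasure \<mu> (P (m + 1)))"
    by (intro sum.cong refl emeasure_translate) simp
  finally show ?thesis by (simp add: card_rep)
qed

text \<open>The volume is 1 at \<open>m = 0\<close> and changes by the factor q at each step. Going
  up, that factor has to be cancelled in \<open>ennreal\<close>, which is legitimate since q is
  positive and finite.\<close>

lemma emeasure_P: "emeasure \<mu> (P m) = ennreal (qr powi (- m))"
proof -
  have q: "qr > 0" using qr_gt_1 by simp
  have qq: "of_nat (residue_card v) = ennreal qr" by (simp add: ennreal_of_nat_eq_real_of_nat)
  have dn: "emeasure \<mu> (P (m - 1)) = ennreal (qr powi (- (m - 1)))"
    if "emeasure \<mu> (P m) = ennreal (qr powi (- m))" for m
  proof -
    have "emeasure \<mu> (P (m - 1)) = ennreal (qr * qr powi (- m))"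
      using that emeasure_P_step[of "m - 1"] q by (simp add: qq ennreal_mult)
    also have "qr * qr powi (- m) = qr powi (- (m - 1))"
      using q power_int_add[of qr 1 "- m"] by simp
    finally show ?thesis .
  qed
  have up: "emeasure \<mu> (P (m + 1)) = ennreal (qr powi (- (m + 1)))"
    if "emeasure \<mu> (P m) = ennreal (qr powi (- m))" for m
  proof -
    have "ennreal qr * emeasure \<mu> (P (m + 1)) = ennreal (qr powi (- m))"
      using that emeasure_P_step[of m] by (simp add: qq)
    also have "qr powi (- m) = qr * qr powi (- (m + 1))"
      using q power_int_add[of qr 1 "- (m + 1)"] by simp
    also have "ennreal \<dots> = ennreal qr * ennreal (qr powi (- (m + 1)))"
      using q by (simp add: ennreal_mult)
    finally show ?thesis
      using q by (simp add: ennreal_mult_cancel_left)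
  qed
  show ?thesis
  proof (induction m rule: int_induct[where k = 0])
    case base
    then show ?case using haar by (simp add: haar_def)
  next
    case (step1 i)
    then show ?case using up by simp
  next
    case (step2 i)
    then show ?case using dn by simp
  qed
qed

lemma measure_P: "measure \<mu> (P m) = qr powi (- m)"
  using qr_gt_1 by (simp add: measure_def emeasure_P)

lemma emeasure_bounded: "A \<subseteq> P N \<Longrightarrow> emeasure \<mu> A < \<infinity>"
  using emeasure_mono[of A "P N" \<mu>] by (simp add: emeasure_P order.strict_trans1)

section \<open>Integrals of locally constant functions\<close>

lemma invariant_indicator:
  fixes f :: "'k \<Rightarrow> 'b::real_vector"
  assumes "\<And>x y. x \<in> A \<Longrightarrow> y \<in> P k \<Longrightarrow> x + y \<in> A"
    and "\<And>x y. x \<in> A \<Longrightarrow> y \<in> P k \<Longrightarrow> f (x + y) = f x" and y: "y \<in> P k"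
  shows "indicat_real A (x + y) *\<^sub>R f (x + y) = indicat_real A x *\<^sub>R f x"
proof (cases "x \<in> A")
  case True
  then show ?thesis using assms by simp
next
  case False
  \<comment> \<open>Stability is assumed in one direction only; the other follows by shifting back
    with \<open>- y\<close>, which also lies in \<open>P k\<close>.\<close>
  have "x + y \<notin> A"
  proof
    assume "x + y \<in> A"
    then have "x + y + - y \<in> A" using assms(1) y P_minus by blast
    with False show False by simp
  qed
  with False show ?thesis by simp
qed

lemma measurable_indicator_invariant:
  fixes f :: "'k \<Rightarrow> 'b::real_normed_vector"
  assumes "\<And>x y. x \<in> A \<Longrightarrow> y \<in> P k \<Longrightarrow> x + y \<in> A"
    and "\<And>x y. x \<in> A \<Longrightarrow> y \<in> P k \<Longrightarrow> f (x + y) = f x"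
  shows "(\<lambda>x. indicat_real A x *\<^sub>R f x) \<in> borel_measurable borel"
  by (rule borel_measurable_invariant[of k]) (rule invariant_indicator, use assms in auto)

lemma stable_sets:
  assumes "\<And>x y. x \<in> A \<Longrightarrow> y \<in> P k \<Longrightarrow> x + y \<in> A"
  shows "A \<in> sets borel"
  using open_if_stable[of A k] assms by simp

lemma integrable_invariant:
  fixes f :: "'k \<Rightarrow> complex"
  assumes "\<And>x y. x \<in> A \<Longrightarrow> y \<in> P k \<Longrightarrow> x + y \<in> A"
    and "\<And>x y. x \<in> A \<Longrightarrow> y \<in> P k \<Longrightarrow> f (x + y) = f x"
    and "A \<subseteq> P N" and bd: "\<And>x. x \<in> A \<Longrightarrow> cmod (f x) \<le> B"
  shows "set_integrable \<mu> A f"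
  unfolding set_integrable_def
proof (rule integrableI_bounded_set[where A = A and B = B])
  show "A \<in> sets \<mu>" using stable_sets[of A k] assms(1) by simp
  show "(\<lambda>x. indicat_real A x *\<^sub>R f x) \<in> borel_measurable \<mu>"
    using measurable_indicator_invariant[of A k f] assms by simp
  show "emeasure \<mu> A < \<infinity>" using assms emeasure_bounded by blast
qed (use bd in auto)

text \<open>The integrand is constant on the q cosets of \<open>P (m + 1)\<close>, each of volume
  \<open>q^(-(m + 1))\<close>. This is how Gauss sums arise from Fresnel integrals.\<close>

lemma integral_P:
  fixes f :: "'k \<Rightarrow> complex"
  assumes inv: "\<And>x y. x \<in> P m \<Longrightarrow> y \<in> P (m + 1) \<Longrightarrow> f (x + y) = f x"
  shows "(LINT x:P m|\<mu>. f x) = of_real (qr powi (- (m + 1))) * (\<Sum>a\<in>rep. f (\<pi> powi m * a))"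
proof -
  define C where "C = (\<lambda>a. (+) (\<pi> powi m * a) ` P (m + 1))"
  have dis: "disjoint_family_on C rep" unfolding C_def by (rule disjoint_cosets)
  have PC: "P m = (\<Union>a\<in>rep. C a)" unfolding C_def by (rule P_decompose)
  have mem: "\<pi> powi m * a \<in> P m" if "a \<in> rep" for a
    using rep_P0[OF that] by (simp add: P_mult_iff)
  have eq: "indicat_real (P m) x *\<^sub>R f x = (\<Sum>a\<in>rep. indicat_real (C a) x *\<^sub>R f (\<pi> powi m * a))" for x
  proof -
    have "indicat_real (P m) x *\<^sub>R f x = (\<Sum>a\<in>rep. indicat_real (C a) x) *\<^sub>R f x"
      unfolding PC using dis by (simp add: indicator_UN_disjoint)
    also have "\<dots> = (\<Sum>a\<in>rep. indicat_real (C a) x *\<^sub>R f x)" by (rule scaleR_sum_left)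
    also have "\<dots> = (\<Sum>a\<in>rep. indicat_real (C a) x *\<^sub>R f (\<pi> powi m * a))"
      by (intro sum.cong refl) (auto simp: C_def indicator_def inv mem)
    finally show ?thesis .
  qed
  have C: "C a \<in> sets \<mu>" "emeasure \<mu> (C a) = ennreal (qr powi (- (m + 1)))" for a
    unfolding C_def by (simp_all add: emeasure_translate emeasure_P)
  have "(LINT x:P m|\<mu>. f x) = (\<Sum>a\<in>rep. LINT x|\<mu>. indicat_real (C a) x *\<^sub>R f (\<pi> powi m * a))"
    unfolding set_lebesgue_integral_def eq
    by (rule Bochner_Integration.integral_sum) (use C in \<open>auto intro!: integrable_scaleR_left integrable_real_indicator\<close>)
  also have "\<dots> = (\<Sum>a\<in>rep. of_real (qr powi (- (m + 1))) * f (\<pi> powi m * a))"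
  proof (rule sum.cong[OF refl])
    fix a
    have "measure \<mu> (C a) = qr powi (- (m + 1))"
      unfolding measure_def C(2) using qr_gt_1 by simp
    then show "(LINT x|\<mu>. indicat_real (C a) x *\<^sub>R f (\<pi> powi m * a)) =
        of_real (qr powi (- (m + 1))) * f (\<pi> powi m * a)"
      using C by (simp add: scaleR_conv_of_real)
  qed
  finally show ?thesis by (simp add: sum_distrib_left)
qed

lemma set_integral_translate:
  fixes f :: "'k \<Rightarrow> complex"
  assumes "(\<lambda>x. indicat_real A x *\<^sub>R f x) \<in> borel_measurable borel"
  shows "(LINT x:A|\<mu>. f x) = (LINT x:{x. a + x \<in> A}|\<mu>. f (a + x))"
proof -
  have "indicat_real {x. a + x \<in> A} x = indicat_real A (a + x)" for x
    by (simp add: indicator_def)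
  then show ?thesis
    unfolding set_lebesgue_integral_def
    using integral_translate[OF assms, of a] by simp
qed

lemma measure_shell: "measure \<mu> (shell v l) = qr powi (- l) - qr powi (- (l + 1))"
  unfolding shell_eq measure_P[symmetric]
  by (rule measure_Diff) (auto simp: emeasure_P intro: P_mono)

lemma set_integral_one:
  assumes "A \<in> sets borel" "A \<subseteq> P N"
  shows "(LINT t:A|\<mu>. (1::complex)) = of_real (measure \<mu> A)"
proof -
  have "(LINT t|\<mu>. indicat_real A t *\<^sub>R (1::complex)) = measure \<mu> A *\<^sub>R 1"
    using assms emeasure_bounded[of A N] by (simp add: less_top)
  then show ?thesis by (simp add: set_lebesgue_integral_def scaleR_conv_of_real)
qed

lemma set_integral_eq_measure:
  assumes "A \<in> sets borel" "A \<subseteq> P N" "\<And>t. t \<in> A \<Longrightarrow> f t = (1::complex)"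
  shows "(LINT t:A|\<mu>. f t) = of_real (measure \<mu> A)"
proof -
  have "(LINT t:A|\<mu>. f t) = (LINT t:A|\<mu>. 1)"
    by (rule set_lebesgue_integral_cong) (use assms in auto)
  then show ?thesis using set_integral_one assms by simp
qed

text \<open>The shells of valuation at least \<open>m\<close> exhaust \<open>P m\<close> up to the
  point 0; analytically the series telescopes with terms tending to 0.\<close>

lemma has_sum_shell_measures:
  "((\<lambda>l. complex_of_real (qr powi (- l) - qr powi (- (l + 1)))) has_sum of_real (qr powi (- m))) {m..}"
proof -
  define f where "f j = qr powi (- (m + int j))" for j
  have f: "f j = qr powi (- m) * (1 / qr) ^ j" for j
  proof -
    have "qr powi (- m + - int j) = qr powi (- m) * qr powi (- int j)"
      using qr_gt_1 by (intro power_int_add) simp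
    then show ?thesis by (simp add: f_def power_int_minus power_one_over inverse_eq_divide)
  qed
  have "(\<lambda>j. (1 / qr) ^ j) \<longlonglongrightarrow> 0" using qr_gt_1 by (intro LIMSEQ_realpow_zero) auto
  then have "f \<longlonglongrightarrow> 0" unfolding f by (rule tendsto_mult_right_zero)
  then have "(\<lambda>j. f j - f (Suc j)) sums (f 0 - 0)" by (rule telescope_sums')
  moreover have "0 \<le> f j - f (Suc j)" for j
    using qr_gt_1 by (simp add: f divide_simps)
  \<comment> \<open>Non-negative terms turn the ordered series into the unconditional sum that
    \<open>has_sum\<close> requires.\<close>
  ultimately have "((\<lambda>j. f j - f (Suc j)) has_sum f 0) UNIV"
    using sums_nonneg_imp_has_sum by fastforce
  then have sm: "((\<lambda>j. complex_of_real (f j - f (Suc j))) has_sum of_real (f 0)) UNIV"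
    by (rule has_sum_of_real)
  have *: "((\<lambda>l. complex_of_real (qr powi (- l) - qr powi (- (l + 1)))) \<circ> (\<lambda>j. m + int j)
      has_sum of_real (qr powi (- m))) UNIV"
  proof -
    have "m + int (Suc j) = m + int j + 1" for j by simp
    then show ?thesis using sm unfolding f_def comp_def by (simp only: of_nat_0 add_0_right)
  qed
  have "inj (\<lambda>j. m + int j)" by (simp add: inj_def)
  note has_sum_reindex[OF this, THEN iffD2, OF *]
  moreover have "range (\<lambda>j. m + int j) = {m..}"
  proof (intro equalityI subsetI)
    fix x assume "x \<in> {m..}"
    then have "x = m + int (nat (x - m))" by simp
    then show "x \<in> range (\<lambda>j. m + int j)" by blast
  qed auto
  ultimately show ?thesis by (simp only:)
qed

end

section \<open>Squares and norms\<close>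

locale odd_local_field_haar = local_field_haar v \<pi> \<mu> for v :: "'k::{field, complete_space} \<Rightarrow> int" and \<pi> \<mu> +
  assumes odd: "odd_residue_char v"
begin

lemma two_nz [simp]: "(2::'k) \<noteq> 0" and v_two [simp]: "v 2 = 0"
proof -
  have 1: "2 \<notin> P 1" using odd by (simp add: odd_residue_char_def)
  then show nz: "(2::'k) \<noteq> 0" by (metis P_0)
  have "1 + 1 \<in> P 0" by (intro P_add P_1)
  then have "2 \<in> P 0" by (simp add: one_add_one)
  then show "v 2 = 0" using 1 nz by (simp add: P_iff)
qed

text \<open>Hensel's lemma as a fixed point theorem: \<open>(1 + y)^2 = 1 + u\<close> says
  \<open>y = (u - y^2) / 2\<close>, and since 2 is a unit this map contracts the complete set
  \<open>P 1\<close> by 1/q, because its difference quotient is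
  \<open>- (x + y) / 2\<close>.\<close>

lemma sqrt_one_plus:
  assumes u: "u \<in> P 1"
  shows "\<exists>w. w\<^sup>2 = 1 + u"
proof -
  define f where "f y = (u - y\<^sup>2) / 2" for y
  define c where "c = qr powr - 1"
  have half: "x / 2 \<in> P 1" if "x \<in> P 1" for x
    using that by (simp add: P_divide_iff)
  have "\<exists>!y\<in>P 1. f y = y"
  proof (rule Banach_fix)
    show "complete (P 1)" using closed_P complete_eq_closed by blast
    show "P 1 \<noteq> {}" using P_0 by blast
    show "0 \<le> c" "c < 1" using qr_gt_1 by (auto simp: c_def)
    show "f ` P 1 \<subseteq> P 1"
    proof (intro subsetI)
      fix x assume "x \<in> f ` P 1"
      then obtain y where y: "y \<in> P 1" "x = f y" by blast
      have "y\<^sup>2 \<in> P 1" using P_power2[OF y(1)] P_mono by simp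
      then show "x \<in> P 1" using u P_diff half by (simp add: y(2) f_def)
    qed
    fix x y assume x: "x \<in> P 1" and y: "y \<in> P 1"
    define z where "z = (x + y) / 2"
    have z: "z \<in> P 1" using x y by (simp add: z_def half P_add)
    have "f x - f y = z * (y - x)" 
      unfolding f_def z_def diff_divide_distrib[symmetric] times_divide_eq_left
      by (simp add: algebra_simps power2_eq_square)
    moreover have "abs_val v (z * (y - x)) \<le> c * abs_val v (x - y)"
    proof (cases "z = 0 \<or> y = x")
      case True
      then show ?thesis using qr_gt_1 by (auto simp: abs_val_def c_def)
    next
      case False
      then have "v (z * (y - x)) = v z + v (y - x)" by (simp add: v_mult)
      moreover have "v (x - y) = v (y - x)" using v_minus[of "x - y"] by simp
      moreover have "1 \<le> v z" using z False by (simp add: P_iff)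
      ultimately have "qr powr - real_of_int (v (z * (y - x))) \<le> qr powr (- 1 + - real_of_int (v (x - y)))"
        using qr_gt_1 by simp
      then show ?thesis using False by (simp only: powr_add) (auto simp: abs_val_def c_def)
    qed
    ultimately show "dist (f x) (f y) \<le> c * dist x y" by (simp add: dist_eq)
  qed
  then obtain y where "f y = y" by blast
  then have "(1 + y)\<^sup>2 = 1 + u" by (simp add: f_def field_simps power2_eq_square)
  then show ?thesis by blast
qed

lemma unit_square_if_cong:
  assumes z: "z \<noteq> 0" "v z = 0" and wz: "w - z\<^sup>2 \<in> P 1"
  shows "\<exists>y. w = y\<^sup>2"
proof -
  have "(w - z\<^sup>2) / z\<^sup>2 \<in> P 1"
    using wz z by (simp add: P_divide_iff v_power)
  then obtain y where "y\<^sup>2 = 1 + (w - z\<^sup>2) / z\<^sup>2" using sqrt_one_plus by blast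
  then have "w = (y * z)\<^sup>2" using z by (simp add: field_simps)
  then show ?thesis by blast
qed

text \<open>\<open>- \<pi>\<close> is the norm of the square root of \<open>\<pi>\<close>: even
  powers times squares are norms of pairs \<open>(a, 0)\<close>, odd ones of pairs
  \<open>(0, b)\<close>.\<close>

lemma norm_groupI:
  assumes "z \<noteq> 0"
  shows "(- \<pi>) powi k * z\<^sup>2 \<in> norm_group \<pi>"
proof (cases "even k")
  case True
  then obtain j where j: "k = 2 * j" by blast
  have "(- \<pi>) powi k * z\<^sup>2 = quad_norm \<pi> ((- \<pi>) powi j * z, 0)"
    by (simp add: quad_norm_def j power_mult_distrib power_int_mult power_int_power mult.commute)
  then show ?thesis using assms by (auto simp: norm_group_def)
next
  case False
  then obtain j where j: "k = 2 * j + 1" by (auto elim: oddE)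
  have "(- \<pi>) powi k * z\<^sup>2 = quad_norm \<pi> (0, (- \<pi>) powi j * z)"
    by (simp add: quad_norm_def j power_mult_distrib power_int_mult power_int_power mult.commute power_int_add)
  then show ?thesis using assms by (auto simp: norm_group_def)
qed

lemma square_times_one_plus:
  assumes a: "a \<noteq> 0" and u: "u \<in> P 1"
  shows "\<exists>z. z \<noteq> 0 \<and> a\<^sup>2 * (1 + u) = z\<^sup>2"
proof -
  obtain w where w: "w\<^sup>2 = 1 + u" using sqrt_one_plus u by blast
  have "1 + u \<noteq> 0" using v_add_eq[of 1 u] u by simp
  then have "w \<noteq> 0" using w by auto
  then show ?thesis using a w by (intro exI[of _ "a * w"]) (simp add: power_mult_distrib)
qed

text \<open>\<open>a^2\<close> and \<open>b^2 * \<pi>\<close> have valuations of opposite parity, so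
  one of them strictly dominates. Factoring it out leaves \<open>1 + u\<close> with \<open>u\<close>
  in \<open>P 1\<close>, which is a square.\<close>

lemma norm_groupE:
  assumes "x \<in> norm_group \<pi>"
  obtains k z where "z \<noteq> 0" "x = (- \<pi>) powi k * z\<^sup>2"
proof -
  obtain a b where ab: "x = a\<^sup>2 - b\<^sup>2 * \<pi>" "a \<noteq> 0 \<or> b \<noteq> 0"
    using assms by (auto simp: norm_group_def quad_norm_def)
  show ?thesis
  \<comment> \<open>For non-zero \<open>a\<close> and \<open>b\<close>, \<open>v a \<le> v b\<close>
    is equivalent to \<open>2 * v a < 2 * v b + 1\<close>, that is, to \<open>a^2\<close> being the
    dominant term.\<close>
  proof (cases "a \<noteq> 0 \<and> (b = 0 \<or> v a \<le> v b)")
    case True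
    define u where "u = - ((b / a)\<^sup>2 * \<pi>)"
    have "u \<in> P 1"
    proof (cases "b = 0")
      case False
      then show ?thesis using True by (simp add: u_def P_iff v_mult v_power v_divide)
    qed (simp add: u_def)
    then obtain z where "z \<noteq> 0" "a\<^sup>2 * (1 + u) = z\<^sup>2" using square_times_one_plus True by blast
    moreover have "x = a\<^sup>2 * (1 + u)" using True by (simp add: ab u_def field_simps)
    ultimately show ?thesis using that[of z 0] by simp
  next
    case False
    then have b: "b \<noteq> 0" using ab by auto
    define u where "u = - (a\<^sup>2 / (b\<^sup>2 * \<pi>))"
    have "u \<in> P 1"
    proof (cases "a = 0")
      case nz: False
      then show ?thesis using b False by (simp add: u_def P_iff v_mult v_power v_divide)
    qed (simp add: u_def)
    then obtain z where "z \<noteq> 0" "b\<^sup>2 * (1 + u) = z\<^sup>2" using square_times_one_plus b by blast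
    moreover have "x = - \<pi> * (b\<^sup>2 * (1 + u))" using b by (simp add: ab u_def field_simps)
    ultimately show ?thesis using that[of z 1] by simp
  qed
qed

text \<open>The normal form: the even power of \<open>- \<pi>\<close> contained in
  \<open>z^2\<close> is moved into the exponent, which leaves a unit \<open>z\<close> and makes the
  exponent equal to \<open>v x\<close>.\<close>

lemma norm_group_iff:
  "x \<in> norm_group \<pi> \<longleftrightarrow> x \<noteq> 0 \<and> (\<exists>z. z \<noteq> 0 \<and> v z = 0 \<and> x = (- \<pi>) powi v x * z\<^sup>2)"
proof
  assume "x \<in> norm_group \<pi>"
  then obtain k z where z: "z \<noteq> 0" "x = (- \<pi>) powi k * z\<^sup>2" by (rule norm_groupE)
  define y where "y = z / (- \<pi>) powi v z"
  have x: "x \<noteq> 0" and vx: "v x = k + 2 * v z" using z by (auto simp: v_mult v_powi v_power)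
  have "z = (- \<pi>) powi v z * y" by (simp add: y_def)
  then have "x = (- \<pi>) powi k * ((- \<pi>) powi v z)\<^sup>2 * y\<^sup>2"
    using z(2) by (metis mult.assoc power_mult_distrib)
  also have "(- \<pi>) powi k * ((- \<pi>) powi v z)\<^sup>2 = (- \<pi>) powi v x"
    unfolding vx mult_2 power2_eq_square by (subst power_int_add, simp)+ simp
  finally have "x = (- \<pi>) powi v x * y\<^sup>2" .
  moreover have "y \<noteq> 0" "v y = 0" using z by (auto simp: y_def v_divide v_powi)
  ultimately show "x \<noteq> 0 \<and> (\<exists>z. z \<noteq> 0 \<and> v z = 0 \<and> x = (- \<pi>) powi v x * z\<^sup>2)" using x by blast
next
  assume "x \<noteq> 0 \<and> (\<exists>z. z \<noteq> 0 \<and> v z = 0 \<and> x = (- \<pi>) powi v x * z\<^sup>2)"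
  then obtain z where "z \<noteq> 0" "x = (- \<pi>) powi v x * z\<^sup>2" by blast
  then show "x \<in> norm_group \<pi>" using norm_groupI[of z "v x"] by simp
qed

lemma norm_group_mult:
  assumes x: "x \<in> norm_group \<pi>" and y: "y \<noteq> 0"
  shows "x * ((- \<pi>) powi k * y\<^sup>2) \<in> norm_group \<pi>"
proof -
  obtain j z where z: "z \<noteq> 0" "x = (- \<pi>) powi j * z\<^sup>2" using x by (rule norm_groupE)
  have "x * ((- \<pi>) powi k * y\<^sup>2) = (- \<pi>) powi (j + k) * (z * y)\<^sup>2"
    by (simp add: z(2) power_int_add power_mult_distrib ac_simps)
  then show ?thesis using norm_groupI[of "z * y" "j + k"] z y by simp
qed

lemma norm_group_mult_iff:
  assumes y: "y \<noteq> 0"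
  shows "x * ((- \<pi>) powi k * y\<^sup>2) \<in> norm_group \<pi> \<longleftrightarrow> x \<in> norm_group \<pi>"
proof
  assume "x * ((- \<pi>) powi k * y\<^sup>2) \<in> norm_group \<pi>"
  from norm_group_mult[OF this, of "inverse y" "- k"]
  show "x \<in> norm_group \<pi>" using y by (simp add: power_int_minus power_inverse field_simps)
qed (rule norm_group_mult[OF _ y])

lemma norm_group_unit: "v x = 0 \<Longrightarrow> x \<noteq> 0 \<Longrightarrow> x \<in> norm_group \<pi> \<longleftrightarrow> (\<exists>z. x = z\<^sup>2)"
proof -
  assume x: "v x = 0" "x \<noteq> 0"
  have "v z = 0" if "x = z\<^sup>2" for z using x that by (cases "z = 0") (auto simp: v_power)
  then show ?thesis using norm_group_iff[of x] x by auto
qed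

text \<open>Elements of \<open>1 + P 1\<close> are squares, so being a norm depends on the leading
  term only; in particular the norm group is open.\<close>

lemma norm_group_stable:
  assumes x: "x \<in> norm_group \<pi>" and y: "y \<in> P (v x + 1)"
  shows "x + y \<in> norm_group \<pi>"
proof -
  obtain k z where z: "z \<noteq> 0" "x = (- \<pi>) powi k * z\<^sup>2" using x by (rule norm_groupE)
  have x0: "x \<noteq> 0" using z by simp
  then have "y / x \<in> P 1"
    using y by (simp add: P_divide_iff add.commute)
  then obtain w where w: "w \<noteq> 0" "z\<^sup>2 * (1 + y / x) = w\<^sup>2" using square_times_one_plus z(1) by blast
  have "x + y = x * (1 + y / x)" using x0 by (simp add: field_simps)
  also have "\<dots> = (- \<pi>) powi k * w\<^sup>2" using w(2) z(2) by (simp add: mult.assoc)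
  finally show ?thesis using norm_groupI w by simp
qed

text \<open>The rational parametrisation of the conic,
  \<open>a = (1 + \<pi> t^2) / (1 - \<pi> t^2)\<close> and \<open>b = 2 t / (1 - \<pi> t^2)\<close>,
  at \<open>t = 1\<close>. A point with \<open>b\<close> non-zero is what detects the parameter of
  the torus and controls its normaliser.\<close>

lemma torus_point:
  obtains a b where "a\<^sup>2 - b\<^sup>2 * \<pi> = 1" "b \<noteq> 0"
proof
  have nz: "1 - \<pi> \<noteq> 0" using v_add_eq[of 1 "- \<pi>"] by (simp add: P_iff)
  then show "2 / (1 - \<pi>) \<noteq> 0" by simp
  have "((1 + \<pi>) / (1 - \<pi>))\<^sup>2 - (2 / (1 - \<pi>))\<^sup>2 * \<pi> = ((1 + \<pi>)\<^sup>2 - 2\<^sup>2 * \<pi>) / (1 - \<pi>)\<^sup>2"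
    by (simp add: power_divide diff_divide_distrib)
  also have "(1 + \<pi>)\<^sup>2 - 2\<^sup>2 * \<pi> = (1 - \<pi>)\<^sup>2" by (simp add: power2_eq_square algebra_simps)
  finally show "((1 + \<pi>) / (1 - \<pi>))\<^sup>2 - (2 / (1 - \<pi>))\<^sup>2 * \<pi> = 1" using nz by simp
qed

end

section \<open>Tori of SL2 and their normalisers\<close>

definition mat2 :: "'a::zero \<Rightarrow> 'a \<Rightarrow> 'a \<Rightarrow> 'a \<Rightarrow> 'a ^ 2 ^ 2" where
  "mat2 a b c d = vector [vector [a, b], vector [c, d]]"

lemma mat2_nth [simp]:
  "mat2 a b c d $ 1 $ 1 = a" "mat2 a b c d $ 1 $ 2 = b"
  "mat2 a b c d $ 2 $ 1 = c" "mat2 a b c d $ 2 $ 2 = d"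
  by (simp_all add: mat2_def)

lemma mat2_eq_iff: "mat2 a b c d = mat2 a' b' c' d' \<longleftrightarrow> a = a' \<and> b = b' \<and> c = c' \<and> d = d'"
  by (auto simp: vec_eq_iff forall_2)

lemma mat2_cases: obtains a b c d where "A = mat2 a b c d"
proof
  show "A = mat2 (A $ 1 $ 1) (A $ 1 $ 2) (A $ 2 $ 1) (A $ 2 $ 2)"
    by (simp add: vec_eq_iff forall_2)
qed

lemma mat2_mult:
  fixes a b c d :: "'a::semiring_1"
  shows "mat2 a b c d ** mat2 a' b' c' d' =
    mat2 (a * a' + b * c') (a * b' + b * d') (c * a' + d * c') (c * b' + d * d')"
  by (simp add: vec_eq_iff forall_2 matrix_matrix_mult_def sum_2)

lemma mat2_det: "det (mat2 a b c d) = a * d - b * (c :: 'a::comm_ring_1)"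
  by (simp add: det_2)

lemma mat2_trace: "trace (mat2 a b c d) = a + (d :: 'a::comm_ring_1)"
  by (simp add: trace_def sum_2)

lemma mat2_one: "mat 1 = mat2 1 0 0 (1 :: 'a::comm_ring_1)"
  by (simp add: vec_eq_iff forall_2 mat_def)

lemma torus_eq: "torus \<theta> = {mat2 a b (b * \<theta>) a | a b. a\<^sup>2 - b\<^sup>2 * \<theta> = 1}"
  by (simp add: torus_def mat2_def)

lemma torusI: "a\<^sup>2 - b\<^sup>2 * \<theta> = 1 \<Longrightarrow> g = mat2 a b (b * \<theta>) a \<Longrightarrow> g \<in> torus \<theta>"
  by (auto simp: torus_eq)

lemma torus_lie_eq: "torus_lie \<theta> c = mat2 0 c (c * \<theta>) 0"
  by (simp add: torus_lie_def mat2_def)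

lemma SL2_simps [simp]:
  "mat2 a b c d \<in> carrier SL2 \<longleftrightarrow> a * d - b * c = 1" "x \<otimes>\<^bsub>SL2\<^esub> y = x ** y" "\<one>\<^bsub>SL2\<^esub> = mat 1"
  by (simp_all add: SL2_def mat2_det)

text \<open>The adjugate. Uniqueness is the usual argument from associativity, carried out directly
  on the definite description behind \<open>m_inv\<close>.\<close>

lemma inv_SL2:
  assumes "a * d - b * c = (1 :: 'k::field)"
  shows "inv\<^bsub>SL2\<^esub> (mat2 a b c d) = mat2 d (- b) (- c) a"
  unfolding m_inv_def
proof (rule the_equality)
  show 1: "mat2 d (- b) (- c) a \<in> carrier SL2 \<and>
      mat2 a b c d \<otimes>\<^bsub>SL2\<^esub> mat2 d (- b) (- c) a = \<one>\<^bsub>SL2\<^esub> \<and>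
      mat2 d (- b) (- c) a \<otimes>\<^bsub>SL2\<^esub> mat2 a b c d = \<one>\<^bsub>SL2\<^esub>"
    using assms by (simp add: mat2_mult mat2_one mat2_eq_iff algebra_simps)
  fix y assume y: "y \<in> carrier SL2 \<and> mat2 a b c d \<otimes>\<^bsub>SL2\<^esub> y = \<one>\<^bsub>SL2\<^esub> \<and> y \<otimes>\<^bsub>SL2\<^esub> mat2 a b c d = \<one>\<^bsub>SL2\<^esub>"
  have "y = y ** (mat2 a b c d ** mat2 d (- b) (- c) a)" using 1 by simp
  also have "\<dots> = y ** mat2 a b c d ** mat2 d (- b) (- c) a" by (rule matrix_mul_assoc)
  also have "\<dots> = mat2 d (- b) (- c) a" using y by simp
  finally show "y = mat2 d (- b) (- c) a" .
qed

text \<open>The elements of the normaliser acting on the torus by inversion.\<close>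

definition anti_torus :: "'k::field \<Rightarrow> ('k ^ 2 ^ 2) set" where
  "anti_torus \<theta> = {mat2 a b (- (b * \<theta>)) (- a) | a b. b\<^sup>2 * \<theta> - a\<^sup>2 = 1}"

lemma anti_torusI:
  "b\<^sup>2 * \<theta> - a\<^sup>2 = 1 \<Longrightarrow> g = mat2 a b (- (b * \<theta>)) (- a) \<Longrightarrow> g \<in> anti_torus \<theta>"
  by (auto simp: anti_torus_def)

lemma torus_subset: "torus \<theta> \<subseteq> carrier SL2"
  by (auto simp: torus_eq power2_eq_square algebra_simps)

lemma conj_image: "g <#\<^bsub>SL2\<^esub> H #>\<^bsub>SL2\<^esub> inv\<^bsub>SL2\<^esub> g = (\<lambda>h. g ** h ** inv\<^bsub>SL2\<^esub> g) ` H"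
  by (auto simp: l_coset_def r_coset_def)

lemma normalizer_torus_iff:
  "g \<in> normalizer SL2 (torus \<theta>) \<longleftrightarrow>
    g \<in> carrier SL2 \<and> (\<lambda>h. g ** h ** inv\<^bsub>SL2\<^esub> g) ` torus \<theta> = torus \<theta>"
  using torus_subset[of \<theta>] by (simp add: normalizer_def stabilizer_def conj_image)

text \<open>Turns a statement about conjugation into a commutation relation, which can be checked
  entry by entry with no inverse in sight.\<close>

lemma conj_eqI:
  assumes g: "g \<in> carrier SL2" and comm: "h ** g = g ** h'"
  shows "inv\<^bsub>SL2\<^esub> g ** h ** g = h'" and "g ** h' ** inv\<^bsub>SL2\<^esub> g = h"
proof -
  obtain a b c d where gm: "g = mat2 a b c d" by (rule mat2_cases)
  have det: "a * d - b * c = 1" using g gm by simp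
  have 1: "inv\<^bsub>SL2\<^esub> g ** g = mat 1" "g ** inv\<^bsub>SL2\<^esub> g = mat 1"
    unfolding gm inv_SL2[OF det] mat2_mult mat2_one mat2_eq_iff
    using det by (simp_all add: algebra_simps)
  show "inv\<^bsub>SL2\<^esub> g ** h ** g = h'"
    unfolding matrix_mul_assoc[symmetric] comm by (simp add: matrix_mul_assoc 1)
  show "g ** h' ** inv\<^bsub>SL2\<^esub> g = h"
    unfolding comm[symmetric] by (simp add: matrix_mul_assoc[symmetric] 1)
qed

lemma anti_torus_subset: "anti_torus \<theta> \<subseteq> carrier SL2"
  by (auto simp: anti_torus_def power2_eq_square algebra_simps)

lemma torus_commute:
  "mat2 x y (y * \<theta>) x ** mat2 a b (b * \<theta>) a =
    mat2 a b (b * \<theta>) a ** mat2 x y (y * \<theta>) (x :: 'k::field)"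
  by (simp add: mat2_mult mat2_eq_iff algebra_simps)

lemma anti_torus_commute:
  "mat2 x (- y) (- y * \<theta>) x ** mat2 a b (- (b * \<theta>)) (- a) =
    mat2 a b (- (b * \<theta>)) (- a) ** mat2 x y (y * \<theta>) (x :: 'k::field)"
  by (simp add: mat2_mult mat2_eq_iff algebra_simps)

text \<open>Conjugating the single torus element with \<open>b0\<close> non-zero already suffices.
  With \<open>n = a^2 - b^2 * \<theta>\<close>, the resulting equations force the second row to be
  \<open>n\<close> times \<open>(b * \<theta>, a)\<close>; then the determinant is
  \<open>n^2\<close>, so \<open>n\<close> is 1 or -1, and these are the two cases of the
  conclusion.\<close>

lemma normalizer_torus_subset:
  fixes \<theta> :: "'k::field"
  assumes two: "(2::'k) \<noteq> 0" and \<theta>: "\<theta> \<noteq> 0" and ab: "a0\<^sup>2 - b0\<^sup>2 * \<theta> = 1" "b0 \<noteq> 0"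
  shows "normalizer SL2 (torus \<theta>) \<subseteq> torus \<theta> \<union> anti_torus \<theta>"
proof
  fix g assume "g \<in> normalizer SL2 (torus \<theta>)"
  then have g: "g \<in> carrier SL2" and im: "(\<lambda>h. g ** h ** inv\<^bsub>SL2\<^esub> g) ` torus \<theta> = torus \<theta>"
    by (simp_all add: normalizer_torus_iff)
  obtain a b c d where gm: "g = mat2 a b c d" by (rule mat2_cases)
  have det: "a * d - b * c = 1" using g gm by simp
  have "mat2 a0 b0 (b0 * \<theta>) a0 \<in> torus \<theta>" using ab by (auto simp: torus_eq)
  then have "g ** mat2 a0 b0 (b0 * \<theta>) a0 ** inv\<^bsub>SL2\<^esub> g \<in> torus \<theta>" using im by blast
  then obtain x y where "g ** mat2 a0 b0 (b0 * \<theta>) a0 ** inv\<^bsub>SL2\<^esub> g = mat2 x y (y * \<theta>) x"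
    by (auto simp: torus_eq)
  then have e: "(a * a0 + b * (b0 * \<theta>)) * d - (a * b0 + b * a0) * c = x"
    "(a * b0 + b * a0) * a - (a * a0 + b * (b0 * \<theta>)) * b = y"
    "(c * a0 + d * (b0 * \<theta>)) * d - (c * b0 + d * a0) * c = y * \<theta>"
    "(c * b0 + d * a0) * a - (c * a0 + d * (b0 * \<theta>)) * b = x"
    unfolding gm inv_SL2[OF det] mat2_mult mat2_eq_iff by (simp_all add: algebra_simps)
  define n where "n = a\<^sup>2 - b\<^sup>2 * \<theta>"
  \<comment> \<open>The two diagonal entries of a torus element agree.\<close>
  have "2 * b0 * (b * d * \<theta> - a * c) = 0"
    using e(1,4) by (simp add: algebra_simps) algebra
  then have ac: "a * c = b * d * \<theta>" using two ab by simp
  have "y = b0 * n" using e(2) by (simp add: n_def algebra_simps power2_eq_square)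
  moreover have "b0 * (d\<^sup>2 * \<theta> - c\<^sup>2) = y * \<theta>"
    using e(3) by (simp add: algebra_simps power2_eq_square)
  ultimately have dc: "d\<^sup>2 * \<theta> - c\<^sup>2 = \<theta> * n" using ab by simp
  \<comment> \<open>Multiplying by the determinant solves for \<open>c\<close>, and below for
    \<open>d\<close>, without dividing by entries that may vanish.\<close>
  have "c = c * (a * d - b * c)" by (simp add: det)
  also have "\<dots> = d * (a * c) - b * c\<^sup>2" by (simp add: algebra_simps power2_eq_square)
  also have "\<dots> = b * (d\<^sup>2 * \<theta> - c\<^sup>2)" by (simp add: ac algebra_simps power2_eq_square)
  finally have c: "c = b * \<theta> * n" by (simp add: dc)
  have "\<theta> * d = \<theta> * d * (a * d - b * c)" by (simp add: det)
  also have "\<dots> = a * (d\<^sup>2 * \<theta>) - b * d * \<theta> * c" by (simp add: algebra_simps power2_eq_square)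
  also have "\<dots> = a * (d\<^sup>2 * \<theta>) - a * c * c" by (simp only: ac)
  also have "\<dots> = a * (d\<^sup>2 * \<theta> - c\<^sup>2)" by (simp add: algebra_simps power2_eq_square)
  finally have "\<theta> * d = \<theta> * (a * n)" by (simp add: dc)
  then have d: "d = a * n" using \<theta> by simp
  have "n * n = a * d - b * c" unfolding c d by (simp add: n_def algebra_simps power2_eq_square)
  then have "n * n = 1" by (simp add: det)
  then have "n = 1 \<or> n = - 1" by (simp add: square_eq_1_iff)
  then show "g \<in> torus \<theta> \<union> anti_torus \<theta>"
  proof
    assume n: "n = 1"
    then show ?thesis using c d n_def by (auto simp: gm torus_eq)
  next
    assume n: "n = - 1"
    then have "b\<^sup>2 * \<theta> - a\<^sup>2 = 1" using n_def by (simp add: algebra_simps)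
    then show ?thesis using c d n by (auto simp: gm anti_torus_def)
  qed
qed

text \<open>Elements of the torus commute with it; elements of \<open>anti_torus\<close> replace
  \<open>y\<close> by \<open>- y\<close>, which preserves the equation of the torus.\<close>

lemma normalizer_torus_supset: "torus \<theta> \<union> anti_torus \<theta> \<subseteq> normalizer SL2 (torus (\<theta> :: 'k::field))"
proof
  fix g assume "g \<in> torus \<theta> \<union> anti_torus \<theta>"
  then show "g \<in> normalizer SL2 (torus \<theta>)"
  proof
    assume g: "g \<in> torus \<theta>"
    then have gc: "g \<in> carrier SL2" using torus_subset by blast
    have "g ** h ** inv\<^bsub>SL2\<^esub> g = h" if "h \<in> torus \<theta>" for h
      using g that by (intro conj_eqI(2)[OF gc]) (auto simp: torus_eq torus_commute)
    then show ?thesis using gc by (simp add: normalizer_torus_iff)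
  next
    assume g: "g \<in> anti_torus \<theta>"
    then have gc: "g \<in> carrier SL2" using anti_torus_subset by blast
    obtain a b where ab: "g = mat2 a b (- (b * \<theta>)) (- a)" using g by (auto simp: anti_torus_def)
    have conj: "g ** mat2 x y (y * \<theta>) x ** inv\<^bsub>SL2\<^esub> g = mat2 x (- y) (- y * \<theta>) x" for x y
      by (rule conj_eqI(2)[OF gc]) (simp only: ab anti_torus_commute)
    have "(\<lambda>h. g ** h ** inv\<^bsub>SL2\<^esub> g) ` torus \<theta> = torus \<theta>"
    proof (intro equalityI subsetI)
      fix h assume "h \<in> (\<lambda>h. g ** h ** inv\<^bsub>SL2\<^esub> g) ` torus \<theta>"
      then obtain x y where "x\<^sup>2 - y\<^sup>2 * \<theta> = 1" "h = mat2 x (- y) (- y * \<theta>) x"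
        by (auto simp: torus_eq conj)
      then show "h \<in> torus \<theta>" by (intro torusI[of x "- y"]) simp_all
    next
      fix h assume "h \<in> torus \<theta>"
      then obtain x y where xy: "x\<^sup>2 - y\<^sup>2 * \<theta> = 1" "h = mat2 x y (y * \<theta>) x" by (auto simp: torus_eq)
      have "mat2 x (- y) (- y * \<theta>) x \<in> torus \<theta>"
        using xy by (intro torusI[of x "- y"]) simp_all
      moreover have "h = g ** mat2 x (- y) (- y * \<theta>) x ** inv\<^bsub>SL2\<^esub> g" by (simp only: conj xy minus_minus)
      ultimately show "h \<in> (\<lambda>h. g ** h ** inv\<^bsub>SL2\<^esub> g) ` torus \<theta>" by blast
    qed
    then show ?thesis using gc by (simp add: normalizer_torus_iff)
  qed
qed

text \<open>\<open>mat2 a b (b * \<theta>) a\<close> is multiplication by \<open>a + b\<close> times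
  the square root of \<open>\<theta>\<close>, so closure is multiplicativity of the norm. An element
  of \<open>anti_torus\<close> has first row of norm -1; hence a torus multiple stays in
  \<open>anti_torus\<close>, and a quotient of two elements falls into the torus.\<close>

lemma torus_mult: "h \<in> torus \<theta> \<Longrightarrow> g \<in> torus \<theta> \<Longrightarrow> h ** g \<in> torus (\<theta> :: 'k::field)"
proof -
  assume "h \<in> torus \<theta>" "g \<in> torus \<theta>"
  then obtain a b x y where *: "a\<^sup>2 - b\<^sup>2 * \<theta> = 1" "x\<^sup>2 - y\<^sup>2 * \<theta> = 1"
    and g: "g = mat2 a b (b * \<theta>) a" and h: "h = mat2 x y (y * \<theta>) x" by (auto simp: torus_eq)
  show "h ** g \<in> torus \<theta>"
  proof (rule torusI)
    have "(x * a + y * b * \<theta>)\<^sup>2 - (x * b + y * a)\<^sup>2 * \<theta> = (a\<^sup>2 - b\<^sup>2 * \<theta>) * (x\<^sup>2 - y\<^sup>2 * \<theta>)"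
      by (simp add: power2_eq_square algebra_simps)
    then show "(x * a + y * b * \<theta>)\<^sup>2 - (x * b + y * a)\<^sup>2 * \<theta> = 1" by (simp add: *)
  qed (simp add: g h mat2_mult mat2_eq_iff algebra_simps)
qed

lemma torus_mult_anti: "h \<in> torus \<theta> \<Longrightarrow> g \<in> anti_torus \<theta> \<Longrightarrow> h ** g \<in> anti_torus (\<theta> :: 'k::field)"
proof -
  assume "h \<in> torus \<theta>" "g \<in> anti_torus \<theta>"
  then obtain a b x y where *: "b\<^sup>2 * \<theta> - a\<^sup>2 = 1" "x\<^sup>2 - y\<^sup>2 * \<theta> = 1"
    and g: "g = mat2 a b (- (b * \<theta>)) (- a)" and h: "h = mat2 x y (y * \<theta>) x"
    by (auto simp: torus_eq anti_torus_def)
  show "h ** g \<in> anti_torus \<theta>"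
  proof (rule anti_torusI)
    have "(x * b - y * a)\<^sup>2 * \<theta> - (x * a - y * b * \<theta>)\<^sup>2 = (b\<^sup>2 * \<theta> - a\<^sup>2) * (x\<^sup>2 - y\<^sup>2 * \<theta>)"
      by (simp add: power2_eq_square algebra_simps)
    then show "(x * b - y * a)\<^sup>2 * \<theta> - (x * a - y * b * \<theta>)\<^sup>2 = 1" by (simp add: *)
  qed (simp add: g h mat2_mult mat2_eq_iff algebra_simps)
qed

lemma torus_inv: "g \<in> torus \<theta> \<Longrightarrow> inv\<^bsub>SL2\<^esub> g \<in> torus (\<theta> :: 'k::field)"
proof -
  assume "g \<in> torus \<theta>"
  then obtain a b where ab: "a\<^sup>2 - b\<^sup>2 * \<theta> = 1" "g = mat2 a b (b * \<theta>) a" by (auto simp: torus_eq)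
  have "inv\<^bsub>SL2\<^esub> g = mat2 a (- b) (- b * \<theta>) a"
    unfolding ab(2) by (subst inv_SL2) (use ab(1) in \<open>simp_all add: power2_eq_square algebra_simps\<close>)
  then show ?thesis using ab by (intro torusI[of a "- b"]) simp_all
qed

lemma anti_mult_inv: "k \<in> anti_torus \<theta> \<Longrightarrow> g \<in> anti_torus \<theta> \<Longrightarrow> k ** inv\<^bsub>SL2\<^esub> g \<in> torus (\<theta> :: 'k::field)"
proof -
  assume "k \<in> anti_torus \<theta>" "g \<in> anti_torus \<theta>"
  then obtain a b x y where g: "b\<^sup>2 * \<theta> - a\<^sup>2 = 1" "g = mat2 a b (- (b * \<theta>)) (- a)"
    and k: "y\<^sup>2 * \<theta> - x\<^sup>2 = 1" "k = mat2 x y (- (y * \<theta>)) (- x)" by (auto simp: anti_torus_def)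
  have i: "inv\<^bsub>SL2\<^esub> g = mat2 (- a) (- b) (b * \<theta>) a"
    unfolding g(2) by (subst inv_SL2) (use g(1) in \<open>simp_all add: power2_eq_square algebra_simps\<close>)
  show "k ** inv\<^bsub>SL2\<^esub> g \<in> torus \<theta>"
  proof (rule torusI)
    have "(y * b * \<theta> - x * a)\<^sup>2 - (y * a - x * b)\<^sup>2 * \<theta> = (b\<^sup>2 * \<theta> - a\<^sup>2) * (y\<^sup>2 * \<theta> - x\<^sup>2)"
      by (simp add: power2_eq_square algebra_simps)
    then show "(y * b * \<theta> - x * a)\<^sup>2 - (y * a - x * b)\<^sup>2 * \<theta> = 1" by (simp add: g(1) k(1))
  qed (simp add: i k(2) mat2_mult mat2_eq_iff algebra_simps)
qed

lemma coset_eq_image: "H #>\<^bsub>SL2\<lparr>carrier := N\<rparr>\<^esub> g = (\<lambda>h. h ** g) ` H"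
  by (auto simp: r_coset_def SL2_def)

lemma mult_inv_cancel:
  assumes g: "g \<in> carrier SL2"
  shows "k ** inv\<^bsub>SL2\<^esub> g ** g = (k :: 'k::field ^ 2 ^ 2)"
  using conj_eqI(1)[OF g, of "mat 1" "mat 1"] by (simp add: matrix_mul_assoc[symmetric])

lemma torus_coset: "g \<in> torus \<theta> \<Longrightarrow> (\<lambda>h. h ** g) ` torus \<theta> = torus (\<theta> :: 'k::field)"
proof (intro equalityI subsetI)
  fix k assume g: "g \<in> torus \<theta>" and k: "k \<in> torus \<theta>"
  have "k = k ** inv\<^bsub>SL2\<^esub> g ** g" by (rule mult_inv_cancel[OF subsetD[OF torus_subset g], symmetric])
  moreover have "k ** inv\<^bsub>SL2\<^esub> g \<in> torus \<theta>" using g k by (intro torus_mult torus_inv)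
  ultimately show "k \<in> (\<lambda>h. h ** g) ` torus \<theta>" by blast
qed (auto intro: torus_mult)

lemma anti_torus_coset: "g \<in> anti_torus \<theta> \<Longrightarrow> (\<lambda>h. h ** g) ` torus \<theta> = anti_torus (\<theta> :: 'k::field)"
proof (intro equalityI subsetI)
  fix k assume g: "g \<in> anti_torus \<theta>" and k: "k \<in> anti_torus \<theta>"
  have "k = k ** inv\<^bsub>SL2\<^esub> g ** g" by (rule mult_inv_cancel[OF subsetD[OF anti_torus_subset g], symmetric])
  moreover have "k ** inv\<^bsub>SL2\<^esub> g \<in> torus \<theta>" using g k by (intro anti_mult_inv)
  ultimately show "k \<in> (\<lambda>h. h ** g) ` torus \<theta>" by blast
qed (auto intro: torus_mult_anti)

lemma one_in_torus: "mat2 1 0 0 1 \<in> torus (\<theta> :: 'k::field)"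
  by (rule torusI[of 1 0]) simp_all

text \<open>The quotient is a set of right cosets, and \<open>anti_torus\<close>, when not empty, is
  a single coset of the torus.\<close>

lemma weyl_group_torus:
  fixes \<theta> :: "'k::field"
  assumes "(2::'k) \<noteq> 0" "\<theta> \<noteq> 0" "a0\<^sup>2 - b0\<^sup>2 * \<theta> = 1" "b0 \<noteq> 0"
  shows "weyl_group SL2 (torus \<theta>) = {torus \<theta>} \<union> (if anti_torus \<theta> = {} then {} else {anti_torus \<theta>})"
proof -
  have N: "normalizer SL2 (torus \<theta>) = torus \<theta> \<union> anti_torus \<theta>"
    using normalizer_torus_subset[OF assms] normalizer_torus_supset by blast
  have "weyl_group SL2 (torus \<theta>) = (\<lambda>g. (\<lambda>h. h ** g) ` torus \<theta>) ` (torus \<theta> \<union> anti_torus \<theta>)"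
    unfolding weyl_group_def FactGroup_def RCOSETS_def coset_eq_image N by auto
  also have "\<dots> = (\<lambda>g. torus \<theta>) ` torus \<theta> \<union> (\<lambda>g. anti_torus \<theta>) ` anti_torus \<theta>"
    by (simp add: image_Un torus_coset anti_torus_coset cong: image_cong)
  also have "\<dots> = {torus \<theta>} \<union> (if anti_torus \<theta> = {} then {} else {anti_torus \<theta>})"
    using one_in_torus[of \<theta>] by auto
  finally show ?thesis .
qed

lemma anti_torus_nonempty_iff: "anti_torus \<theta> \<noteq> {} \<longleftrightarrow> - 1 \<in> norm_group (\<theta> :: 'k::field)"
proof
  assume "anti_torus \<theta> \<noteq> {}"
  then obtain a b where ab: "b\<^sup>2 * \<theta> - a\<^sup>2 = 1" by (auto simp: anti_torus_def)
  then have "- 1 = quad_norm \<theta> (a, b)" by (simp add: quad_norm_def algebra_simps)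
  moreover have "(a, b) \<noteq> (0, 0)" using ab by auto
  ultimately show "- 1 \<in> norm_group \<theta>" unfolding norm_group_def by blast
next
  assume "- 1 \<in> norm_group \<theta>"
  then obtain a b where "- 1 = a\<^sup>2 - b\<^sup>2 * \<theta>" by (auto simp: norm_group_def quad_norm_def)
  then have "b\<^sup>2 * \<theta> - a\<^sup>2 = 1" by (simp add: algebra_simps)
  then show "anti_torus \<theta> \<noteq> {}" unfolding anti_torus_def by blast
qed

text \<open>The identity matrix would give \<open>1 = - 1\<close>. This guarantees that the Weyl sum
  really has two terms when \<open>anti_torus\<close> is not empty.\<close>

lemma torus_neq_anti_torus:
  assumes "(2::'k::field) \<noteq> 0"
  shows "torus \<theta> \<noteq> anti_torus (\<theta> :: 'k)"
proof
  assume "torus \<theta> = anti_torus \<theta>"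
  then have "mat2 1 0 0 1 \<in> anti_torus \<theta>" using one_in_torus by blast
  then have "(1::'k) = - 1" by (auto simp: anti_torus_def mat2_eq_iff)
  then have "1 + 1 = (0::'k)" by (metis add.right_inverse)
  then show False using assms by simp
qed

section \<open>Coadjoint action and the sum over the Weyl group\<close>

lemma coadjoint_torus:
  assumes g: "g \<in> torus \<theta>"
  shows "coadjoint g (trace_functional (torus_lie \<theta> \<beta>)) (torus_lie \<theta> s) = 2 * \<beta> * (s * (\<theta> :: 'k::field))"
proof -
  have "inv\<^bsub>SL2\<^esub> g ** torus_lie \<theta> s ** g = torus_lie \<theta> s"
  proof (rule conj_eqI(1))
    show "g \<in> carrier SL2" using g torus_subset by blast
    show "torus_lie \<theta> s ** g = g ** torus_lie \<theta> s"
      using g torus_commute[of 0 s \<theta>] by (auto simp: torus_eq torus_lie_eq)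
  qed
  then show ?thesis
    by (simp add: coadjoint_def trace_functional_def torus_lie_eq mat2_mult mat2_trace algebra_simps)
qed

text \<open>Conjugation by \<open>anti_torus\<close> negates the Lie algebra of the torus, so the
  trace pairing \<open>2 * \<beta> * s * \<theta>\<close> changes sign.\<close>

lemma coadjoint_anti_torus:
  assumes g: "g \<in> anti_torus \<theta>"
  shows "coadjoint g (trace_functional (torus_lie \<theta> \<beta>)) (torus_lie \<theta> s) = - 2 * \<beta> * (s * (\<theta> :: 'k::field))"
proof -
  have "inv\<^bsub>SL2\<^esub> g ** torus_lie \<theta> s ** g = torus_lie \<theta> (- s)"
  proof (rule conj_eqI(1))
    show "g \<in> carrier SL2" using g anti_torus_subset by blast
    show "torus_lie \<theta> s ** g = g ** torus_lie \<theta> (- s)"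
      using g anti_torus_commute[of 0 "- s" \<theta>] by (auto simp: anti_torus_def torus_lie_eq)
  qed
  then show ?thesis
    by (simp add: coadjoint_def trace_functional_def torus_lie_eq mat2_mult mat2_trace algebra_simps)
qed

text \<open>The arbitrary choice of a coset representative is harmless, since the pairing is
  constant on the torus and on \<open>anti_torus\<close>.\<close>

lemma sum_weyl_group_torus:
  fixes \<theta> :: "'k::field" and f :: "'k \<Rightarrow> complex"
  assumes "(2::'k) \<noteq> 0" "\<theta> \<noteq> 0" "a0\<^sup>2 - b0\<^sup>2 * \<theta> = 1" "b0 \<noteq> 0"
  shows "(\<Sum>\<sigma>\<in>weyl_group SL2 (torus \<theta>).
      f (coadjoint (SOME g. g \<in> \<sigma>) (trace_functional (torus_lie \<theta> \<beta>)) (torus_lie \<theta> s))) =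
    f (2 * \<beta> * (s * \<theta>)) + (if - 1 \<in> norm_group \<theta> then f (- 2 * \<beta> * (s * \<theta>)) else 0)"
proof -
  have T: "(SOME g. g \<in> torus \<theta>) \<in> torus \<theta>" using one_in_torus by (rule someI)
  have A: "(SOME g. g \<in> anti_torus \<theta>) \<in> anti_torus \<theta>" if "anti_torus \<theta> \<noteq> {}"
    using that by (simp add: some_in_eq)
  show ?thesis
    unfolding weyl_group_torus[OF assms] anti_torus_nonempty_iff[symmetric]
    using coadjoint_torus[OF T] coadjoint_anti_torus[OF A] torus_neq_anti_torus[OF assms(1), of \<theta>]
    by auto
qed

section \<open>Gauss sums and Fresnel integrals\<close>

locale local_field_character = odd_local_field_haar v \<pi> \<mu>
  for v :: "'k::{field, complete_space} \<Rightarrow> int" and \<pi> \<mu> +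
  fixes \<psi> :: "'k \<Rightarrow> complex" and d :: int
  assumes psi_add: "\<psi> (x + y) = \<psi> x * \<psi> y"
    and psi_norm [simp]: "cmod (\<psi> x) = 1"
    and psi_triv: "x \<in> frac_ideal v (d + 1) \<Longrightarrow> \<psi> x = 1"
    and psi_nontriv: "\<exists>x\<in>frac_ideal v d. \<psi> x \<noteq> 1"
begin

section \<open>Characters of depth exactly \<open>d\<close> and oscillation\<close>

lemma psi_0 [simp]: "\<psi> 0 = 1"
  by (rule psi_triv) simp

lemma psi_nz [simp]: "\<psi> x \<noteq> 0"
  using psi_norm[of x] by (metis norm_zero zero_neq_one)

lemma psi_cong: "x - y \<in> P (d + 1) \<Longrightarrow> \<psi> x = \<psi> y"
  using psi_add[of "x - y" y] psi_triv[of "x - y"] by simp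

lemma psi_mult_cong: "c * (x - y) \<in> P (d + 1) \<Longrightarrow> \<psi> (c * x) = \<psi> (c * y)"
  by (rule psi_cong) (simp add: algebra_simps)

text \<open>Orthogonality: translating by \<open>b\<close> with \<open>\<psi> (c * b)\<close>
  different from 1 permutes the classes but multiplies the sum by that value.\<close>

lemma sum_psi_rep:
  assumes c: "c \<noteq> 0" "v c = d"
  shows "(\<Sum>a\<in>rep. \<psi> (c * a)) = 0"
proof -
  obtain x where x: "x \<in> P d" "\<psi> x \<noteq> 1" using psi_nontriv by blast
  define b where "b = x / c"
  have b: "b \<in> P 0" "\<psi> (c * b) \<noteq> 1" using x c by (simp_all add: b_def P_divide_iff)
  have "(\<Sum>a\<in>rep. \<psi> (c * (a + b))) = (\<Sum>a\<in>rep. \<psi> (c * a))"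
  proof (rule sum_rep_perm[where f = "\<lambda>a. \<psi> (c * a)"])
    fix x y assume "x - y \<in> P 1"
    then show "\<psi> (c * x) = \<psi> (c * y)" by (intro psi_mult_cong) (simp add: P_mult_iff c)
  qed (use b in \<open>auto intro: P_add\<close>)
  then have "(\<Sum>a\<in>rep. \<psi> (c * a)) * \<psi> (c * b) = (\<Sum>a\<in>rep. \<psi> (c * a))"
    by (simp add: distrib_left psi_add sum_distrib_right)
  then show ?thesis using b by (metis mult_cancel_left1)
qed

text \<open>Averaging the translation-invariant integral over \<open>\<pp>\<^sup>k / \<pp>\<^sup>k\<^sup>+\<^sup>1\<close> replaces the integrand by a multiple of a
  complete character sum.\<close>

lemma integral_eq_0_if_oscillating:
  fixes f :: "'k \<Rightarrow> complex"
  assumes stable: "\<And>x y. x \<in> A \<Longrightarrow> y \<in> P k \<Longrightarrow> x + y \<in> A"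
    and osc: "\<And>x y. x \<in> A \<Longrightarrow> y \<in> P k \<Longrightarrow> f (x + y) = f x * \<psi> (c x * y)"
    and c: "\<And>x. x \<in> A \<Longrightarrow> c x \<noteq> 0 \<and> v (c x) = d - k"
    and A: "A \<subseteq> P N" and bd: "\<And>x. x \<in> A \<Longrightarrow> cmod (f x) \<le> B"
  shows "(LINT x:A|\<mu>. f x) = 0"
proof -
  define g where "g x = indicat_real A x *\<^sub>R f x" for x
  have st: "x + y \<in> A \<longleftrightarrow> x \<in> A" if "y \<in> P k" for x y
    using stable[of x y] stable[of "x + y" "- y"] that by auto
  \<comment> \<open>One level deeper the multiplier is trivial, so \<open>f\<close> is locally
    constant; this supplies measurability and integrability.\<close>
  have inv: "f (x + y) = f x" if "x \<in> A" "y \<in> P (k + 1)" for x y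
  proof -
    have "\<psi> (c x * y) = 1" using that c by (intro psi_triv) (simp add: P_mult_iff add.commute)
    then show ?thesis using osc that P_mono[of y "k + 1" k] by simp
  qed
  have st1: "x + y \<in> A" if "x \<in> A" "y \<in> P (k + 1)" for x y
    using stable that P_mono[of y "k + 1" k] by simp
  have g: "g \<in> borel_measurable borel"
    unfolding g_def using measurable_indicator_invariant[of A "k + 1" f] st1 inv by blast
  have int: "integrable \<mu> g"
    using integrable_invariant[of A "k + 1" f, OF st1 inv A bd] unfolding set_integrable_def g_def .
  have gs: "g (\<pi> powi k * a + x) = g x * \<psi> (c x * (\<pi> powi k * a))" if "a \<in> rep" for a x
  proof -
    have "\<pi> powi k * a \<in> P k" using rep_P0[OF that] by (simp add: P_mult_iff)
    then have "g (x + \<pi> powi k * a) = g x * \<psi> (c x * (\<pi> powi k * a))"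
      using st osc by (cases "x \<in> A") (simp_all add: g_def)
    then show ?thesis by (simp add: add.commute)
  qed
  have "qr * integral\<^sup>L \<mu> g = (\<Sum>a\<in>rep. LINT x|\<mu>. g (\<pi> powi k * a + x))"
    using g by (simp add: integral_translate card_rep)
  also have "\<dots> = (\<Sum>a\<in>rep. LINT x|\<mu>. g x * \<psi> (c x * (\<pi> powi k * a)))"
    by (intro sum.cong refl) (simp add: gs)
  also have "\<dots> = (LINT x|\<mu>. (\<Sum>a\<in>rep. g x * \<psi> (c x * (\<pi> powi k * a))))"
  proof (rule Bochner_Integration.integral_sum[symmetric])
    fix a assume a: "a \<in> rep"
    have "integrable \<mu> (\<lambda>x. g (\<pi> powi k * a + x))"
    proof (rule Bochner_Integration.integrable_bound[OF int])
      have "(\<lambda>x. g (\<pi> powi k * a + x)) \<in> borel_measurable borel"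
        using measurable_compose[OF translation_measurable g] .
      then show "(\<lambda>x. g (\<pi> powi k * a + x)) \<in> borel_measurable \<mu>" by simp
      show "AE x in \<mu>. cmod (g (\<pi> powi k * a + x)) \<le> cmod (g x)"
        by (simp add: gs a norm_mult)
    qed
    then show "integrable \<mu> (\<lambda>x. g x * \<psi> (c x * (\<pi> powi k * a)))" by (simp add: gs a)
  qed
  also have "(\<lambda>x. \<Sum>a\<in>rep. g x * \<psi> (c x * (\<pi> powi k * a))) = (\<lambda>x. 0)"
  proof
    fix x
    have "(\<Sum>a\<in>rep. \<psi> ((c x * \<pi> powi k) * a)) = 0" if "x \<in> A"
      using c[OF that] by (intro sum_psi_rep) (simp_all add: v_mult)
    then show "(\<Sum>a\<in>rep. g x * \<psi> (c x * (\<pi> powi k * a))) = 0"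
      by (cases "x \<in> A") (simp_all add: g_def sum_distrib_left[symmetric] mult.assoc)
  qed
  finally have "qr * integral\<^sup>L \<mu> g = 0" by simp
  then have "integral\<^sup>L \<mu> g = 0" using qr_gt_1 by simp
  then show ?thesis unfolding g_def set_lebesgue_integral_def .
qed

section \<open>Quadratic Gauss sums over the residue field\<close>

definition gsum :: "'k \<Rightarrow> complex" where
  "gsum c = (\<Sum>a\<in>rep. \<psi> (c * a\<^sup>2))"

lemma gsum_square:
  assumes c: "c \<noteq> 0" "v c = d" and w: "w \<noteq> 0" "v w = 0"
  shows "gsum (c * w\<^sup>2) = gsum c"
proof -
  have "(\<Sum>a\<in>rep. \<psi> (c * (w * a)\<^sup>2)) = (\<Sum>a\<in>rep. \<psi> (c * a\<^sup>2))"
  proof (rule sum_rep_perm[where f = "\<lambda>a. \<psi> (c * a\<^sup>2)"])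
    fix x y assume "x \<in> P 0" "y \<in> P 0" "x - y \<in> P 1"
    then show "\<psi> (c * x\<^sup>2) = \<psi> (c * y\<^sup>2)"
      using c by (intro psi_mult_cong) (simp add: P_mult_iff P_power2_diff)
  qed (use w in \<open>simp_all add: unit_mult_P_iff right_diff_distrib[symmetric]\<close>)
  then show ?thesis by (simp add: gsum_def power_mult_distrib mult.assoc)
qed

text \<open>As \<open>a\<close> runs over the units, \<open>a\<^sup>2\<close> and \<open>w a\<^sup>2\<close> together hit every residue class of units exactly twice,
  so \<open>gsum c + gsum (c * w)\<close> is twice a complete character sum.\<close>

lemma gsum_nonsquare:
  assumes c: "c \<noteq> 0" "v c = d" and w: "w \<noteq> 0" "v w = 0" and ns: "\<nexists>z. w = z\<^sup>2"
  shows "gsum (c * w) = - gsum c"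
proof -
  define U where "U = {a \<in> rep. a \<notin> P 1}"
  have U: "a \<in> rep" "a \<in> P 0" "a \<noteq> 0" "v a = 0" if "a \<in> U" for a
  proof -
    show 1: "a \<in> rep" and 2: "a \<in> P 0" using that rep_P0 by (auto simp: U_def)
    show 3: "a \<noteq> 0" using that by (auto simp: U_def)
    show "v a = 0" using 2 3 that by (auto simp: U_def P_iff)
  qed
  have finU [simp]: "finite U" by (simp add: U_def)
  have redU: "red x \<in> U" if "x \<noteq> 0" "v x = 0" for x
  proof -
    have x: "x \<in> P 0" using that by (simp add: P_iff)
    have "red x \<notin> P 1"
    proof
      assume "red x \<in> P 1"
      then have "x - red x + red x \<in> P 1" using red(2)[OF x] P_add by blast
      then show False using that by (simp add: P_iff)
    qed
    then show ?thesis using red(1)[OF x] by (simp add: U_def)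
  qed
  have redeq: "red x = red y \<longleftrightarrow> x - y \<in> P 1" if "x \<in> P 0" "y \<in> P 0" for x y
  proof
    assume "red x = red y"
    moreover have "x - red x - (y - red y) \<in> P 1" by (rule P_diff) (use that red(2) in auto)
    ultimately show "x - y \<in> P 1" by simp
  next
    assume xy: "x - y \<in> P 1"
    have "(x - y) - (x - red x) + (y - red y) \<in> P 1"
      by (rule P_add[OF P_diff]) (use that red(2) xy in auto)
    then show "red x = red y" using that red(1) by (intro rep_eq) auto
  qed
  have split: "(\<Sum>a\<in>rep. h a) = h (red 0) + (\<Sum>a\<in>U. h a)" for h :: "'k \<Rightarrow> complex"
  proof -
    have r0: "red 0 \<in> rep" "red 0 \<in> P 1" using red[of 0] by simp_all
    then have "rep = insert (red 0) U" using rep_eq[OF _ r0(1)] P_diff[OF _ r0(2)] by (auto simp: U_def)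
    moreover have "red 0 \<notin> U" using r0 by (simp add: U_def)
    ultimately show ?thesis by simp
  qed
  have psi_red: "\<psi> (e * red x) = \<psi> (e * x)" if "x \<in> P 0" "e \<noteq> 0" "v e = d" for e x
    using that red(2)[of x] by (intro psi_mult_cong) (simp add: P_mult_iff P_diff_commute)
  \<comment> \<open>Squaring and multiplication by the non-square \<open>w\<close>, transported to
    representatives of residue units.\<close>
  define \<sigma> where "\<sigma> a = red (a\<^sup>2)" for a
  define \<nu> where "\<nu> b = red (w * b)" for b
  have sq: "a\<^sup>2 \<noteq> 0" "v (a\<^sup>2) = 0" "a\<^sup>2 \<in> P 0" if "a \<in> U" for a
    using U[OF that] by (simp_all add: v_power P_iff)
  have wm: "w * a \<noteq> 0" "v (w * a) = 0" "w * a \<in> P 0" if "a \<in> U" for a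
    using U[OF that] w by (simp_all add: v_mult P_iff)
  have sU: "\<sigma> ` U \<subseteq> U" using sq redU by (auto simp: \<sigma>_def)
  have nU: "\<nu> ` U \<subseteq> U" using wm redU by (auto simp: \<nu>_def)
  have inj: "inj_on \<nu> U"
  proof (rule inj_onI)
    fix a b assume ab: "a \<in> U" "b \<in> U" "\<nu> a = \<nu> b"
    then have "w * (a - b) \<in> P 1" using redeq wm by (simp add: \<nu>_def right_diff_distrib)
    then show "a = b" using w U ab rep_eq by (simp add: unit_mult_P_iff)
  qed
  \<comment> \<open>The fibre consists of the classes of \<open>a\<close> and \<open>- a\<close>,
    which differ because 2 is a unit.\<close>
  have fiber: "card {a \<in> U. \<sigma> a = b} = 2" if b: "b \<in> \<sigma> ` U" for b
  proof -
    obtain a where a: "a \<in> U" "b = \<sigma> a" using b by blast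
    define a' where "a' = red (- a)"
    have a': "a' \<in> U" "- a - a' \<in> P 1" using redU[of "- a"] red(2)[of "- a"] U[OF a(1)] by (auto simp: a'_def)
    have "a \<noteq> a'"
    proof
      assume "a = a'"
      then have "(- 2) * a \<in> P 1" using a' by simp
      then have "a \<in> P 1" by (simp add: P_mult_iff)
      then show False using a by (simp add: U_def)
    qed
    moreover have "{a \<in> U. \<sigma> a = b} = {a, a'}"
    proof (intro equalityI subsetI)
      fix x assume "x \<in> {a \<in> U. \<sigma> a = b}"
      then have x: "x \<in> U" "\<sigma> x = \<sigma> a" using a by auto
      then have "x\<^sup>2 - a\<^sup>2 \<in> P 1" using redeq sq a by (simp add: \<sigma>_def)
      then have *: "(x - a) * (x + a) \<in> P 1" by (simp add: algebra_simps power2_eq_square)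
      show "x \<in> {a, a'}"
      proof (cases "x - a \<in> P 1")
        case True
        then show ?thesis using rep_eq U a x by blast
      next
        case False
        then have xa: "x - a \<noteq> 0" "\<not> 1 \<le> v (x - a)" by (auto simp: frac_ideal_def)
        have "x - a \<in> P 0" by (rule P_diff) (use U x a in auto)
        then have "v (x - a) = 0" using xa by (simp add: P_iff)
        then have "x + a \<in> P 1" using * xa by (simp add: P_mult_iff)
        then have "x + a + (- a - a') \<in> P 1" using a'(2) by (rule P_add)
        then have "x = a'" using rep_eq U x a' by simp
        then show ?thesis by simp
      qed
    next
      fix x assume "x \<in> {a, a'}"
      moreover have "\<sigma> a' = \<sigma> a"
      proof -
        have "(a' - a) * (a' + a) \<in> P (0 + 1)"
        proof (rule P_mult)
          show "a' - a \<in> P 0" by (rule P_diff) (use U a a' in auto)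
          show "a' + a \<in> P 1" using P_minus[of "- a - a'" 1] a'(2) by (simp add: add.commute)
        qed
        then have "a'\<^sup>2 - a\<^sup>2 \<in> P 1" by (simp add: algebra_simps power2_eq_square)
        then show ?thesis using redeq sq a a' by (simp add: \<sigma>_def)
      qed
      ultimately show "x \<in> {a \<in> U. \<sigma> a = b}" using a a' by auto
    qed
    ultimately show ?thesis by simp
  qed
  have sum2: "(\<Sum>a\<in>U. h (\<sigma> a)) = 2 * (\<Sum>b\<in>\<sigma> ` U. h b)" for h :: "'k \<Rightarrow> complex"
  proof -
    have "(\<Sum>a\<in>U. h (\<sigma> a)) = (\<Sum>b\<in>\<sigma> ` U. \<Sum>a | a \<in> U \<and> \<sigma> a = b. h (\<sigma> a))"
      by (rule sum.image_gen) simp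
    also have "\<dots> = (\<Sum>b\<in>\<sigma> ` U. 2 * h b)"
      by (intro sum.cong refl) (simp add: fiber)
    finally show ?thesis by (simp add: sum_distrib_left)
  qed
  have "complex_of_nat (2 * card (\<sigma> ` U)) = of_nat (card U)"
    using sum2[of "\<lambda>_. 1"] by simp
  then have "2 * card (\<sigma> ` U) = card U" by (rule of_nat_eq_iff[THEN iffD1])
  moreover have "card (\<nu> ` \<sigma> ` U) = card (\<sigma> ` U)"
    using inj sU by (intro card_image) (rule inj_on_subset)
  \<comment> \<open>A common class would make \<open>w\<close> congruent to the square of a unit,
    hence a square by Hensel. With the count of squares as half of \<open>U\<close>, disjointness
    forces the two images to fill \<open>U\<close>.\<close>
  moreover have disj: "\<sigma> ` U \<inter> \<nu> ` \<sigma> ` U = {}"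
  proof (rule ccontr)
    assume "\<sigma> ` U \<inter> \<nu> ` \<sigma> ` U \<noteq> {}"
    then obtain a b where ab: "a \<in> U" "b \<in> U" "\<sigma> a = \<nu> (\<sigma> b)" by blast
    have "\<sigma> b \<in> U" using sU ab by blast
    then have "a\<^sup>2 - w * \<sigma> b \<in> P 1" using redeq sq wm ab by (simp add: \<sigma>_def \<nu>_def)
    moreover have "w * (\<sigma> b - b\<^sup>2) \<in> P 1"
      using red(2)[of "b\<^sup>2"] sq ab w by (simp add: \<sigma>_def unit_mult_P_iff P_diff_commute)
    ultimately have "a\<^sup>2 - w * \<sigma> b + w * (\<sigma> b - b\<^sup>2) \<in> P 1" by (rule P_add)
    then have "a\<^sup>2 - w * b\<^sup>2 \<in> P 1" by (simp add: algebra_simps)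
    then have "(a\<^sup>2 - w * b\<^sup>2) / b\<^sup>2 \<in> P 1" using sq ab by (simp add: P_divide_iff)
    then have "w - (a / b)\<^sup>2 \<in> P 1"
      using U ab by (subst P_diff_commute) (simp add: field_simps)
    then show False using unit_square_if_cong[of "a / b" w] U ab ns by (auto simp: v_divide)
  qed
  moreover have "card (\<sigma> ` U \<union> \<nu> ` \<sigma> ` U) = card (\<sigma> ` U) + card (\<nu> ` \<sigma> ` U)"
    using disj by (intro card_Un_disjoint) auto
  ultimately have "card (\<sigma> ` U \<union> \<nu> ` \<sigma> ` U) = card U" by simp
  then have Un: "\<sigma> ` U \<union> \<nu> ` \<sigma> ` U = U"
    using sU nU by (intro card_subset_eq) auto
  have cw: "c * w \<noteq> 0" "v (c * w) = d" using c w by (simp_all add: v_mult)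
  have g: "gsum e = 1 + 2 * (\<Sum>b\<in>\<sigma> ` U. \<psi> (e * b))" if e: "e \<noteq> 0" "v e = d" for e
  proof -
    \<comment> \<open>The representative of the zero class is an arbitrary element of
      \<open>P 1\<close>, not necessarily 0.\<close>
    have "\<psi> (e * (red 0)\<^sup>2) = \<psi> (e * red 0)"
    proof (rule psi_mult_cong)
      have "red 0 \<in> P 1" using red(2)[of 0] by simp
      then have "red 0 * red 0 - red 0 \<in> P 1"
        using P_mult[of "red 0" 1 "red 0" 1] P_mono[of _ 2 1] by (simp add: P_diff)
      then show "e * ((red 0)\<^sup>2 - red 0) \<in> P (d + 1)" using e by (simp add: P_mult_iff power2_eq_square)
    qed
    also have "\<dots> = 1" using psi_red[of 0 e] e by simp
    finally have "gsum e = 1 + (\<Sum>a\<in>U. \<psi> (e * a\<^sup>2))" by (simp add: gsum_def split)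
    also have "(\<Sum>a\<in>U. \<psi> (e * a\<^sup>2)) = (\<Sum>a\<in>U. \<psi> (e * \<sigma> a))"
      using e sq by (intro sum.cong refl) (simp add: \<sigma>_def psi_red)
    also have "\<dots> = 2 * (\<Sum>b\<in>\<sigma> ` U. \<psi> (e * b))" by (rule sum2)
    finally show ?thesis .
  qed
  have "(\<Sum>b\<in>\<sigma> ` U. \<psi> (c * w * b)) = (\<Sum>b\<in>\<sigma> ` U. \<psi> (c * \<nu> b))"
    using c wm sU by (intro sum.cong refl) (auto simp: \<nu>_def psi_red mult.assoc)
  also have "\<dots> = (\<Sum>b\<in>\<nu> ` \<sigma> ` U. \<psi> (c * b))"
    using inj_on_subset[OF inj sU] by (simp add: sum.reindex)
  finally have "gsum c + gsum (c * w) = 2 * (1 + ((\<Sum>b\<in>\<sigma> ` U. \<psi> (c * b)) + (\<Sum>b\<in>\<nu> ` \<sigma> ` U. \<psi> (c * b))))"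
    by (simp add: g[OF c] g[OF cw] algebra_simps)
  also have "(\<Sum>b\<in>\<sigma> ` U. \<psi> (c * b)) + (\<Sum>b\<in>\<nu> ` \<sigma> ` U. \<psi> (c * b)) = (\<Sum>b\<in>U. \<psi> (c * b))"
    using disj by (subst sum.union_disjoint[symmetric]) (simp_all add: Un)
  also have "1 + \<dots> = (\<Sum>b\<in>rep. \<psi> (c * b))" using psi_red[of 0 c] c by (simp add: split)
  also have "\<dots> = 0" using c by (rule sum_psi_rep)
  finally show ?thesis by (simp add: add_eq_0_iff)
qed

text \<open>The exponent \<open>\<lceil>(d - v c) / 2\<rceil>\<close> is the least valuation of \<open>t\<close> whose shell need not integrate to \<open>0\<close>.\<close>

definition fresnel :: "'k \<Rightarrow> complex" where
  "fresnel c = (LINT t:P ((d - v c + 1) div 2)|\<mu>. \<psi> (c * t\<^sup>2))"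

section \<open>Fresnel integrals shell by shell\<close>

lemma quadratic_phase_invariant:
  assumes c: "c \<noteq> 0" "d \<le> v c + 2 * m" and t: "t \<in> P m" and y: "y \<in> P (m + 1)"
  shows "\<psi> (c * (t + y)\<^sup>2) = \<psi> (c * t\<^sup>2)"
proof (rule psi_mult_cong)
  have "2 * t + y \<in> P m" using t y P_mono[of y "m + 1" m] by (intro P_add) (simp_all add: P_mult_iff)
  then have "y * (2 * t + y) \<in> P (m + 1 + m)" by (intro P_mult y)
  then have "y * (2 * t + y) \<in> P (d + 1 - v c)" by (rule P_mono) (use c in simp)
  moreover have "(t + y)\<^sup>2 - t\<^sup>2 = y * (2 * t + y)" by (simp add: power2_eq_square algebra_simps)
  ultimately show "c * ((t + y)\<^sup>2 - t\<^sup>2) \<in> P (d + 1)"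
    using c by (simp add: P_mult_iff)
qed

lemma quadratic_phase_trivial:
  assumes c: "c \<noteq> 0" "d < v c + 2 * m" and t: "t \<in> P m"
  shows "\<psi> (c * t\<^sup>2) = 1"
proof (rule psi_triv)
  have "t\<^sup>2 \<in> P (d + 1 - v c)" by (rule P_mono[OF P_power2[OF t]]) (use c in simp)
  then show "c * t\<^sup>2 \<in> P (d + 1)" using c by (simp add: P_mult_iff)
qed

text \<open>On the boundary shell \<open>c * t^2\<close> has valuation exactly \<open>d\<close>,
  where \<open>\<psi>\<close> still sees the residue class of the unit part; the scaling
  \<open>t = \<pi> powi m * a\<close> leaves a finite Gauss sum.\<close>

lemma fresnel_even:
  assumes c: "c \<noteq> 0" "v c + 2 * m = d"
  shows "fresnel c = of_real (qr powi (- (m + 1))) * gsum (c * (\<pi> powi m)\<^sup>2)"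
proof -
  have m: "(d - v c + 1) div 2 = m" using c by presburger
  have "fresnel c = of_real (qr powi (- (m + 1))) * (\<Sum>a\<in>rep. \<psi> (c * (\<pi> powi m * a)\<^sup>2))"
    unfolding fresnel_def m by (rule integral_P) (use c in \<open>auto intro: quadratic_phase_invariant\<close>)
  then show ?thesis by (simp add: gsum_def power_mult_distrib mult.assoc)
qed

text \<open>By parity \<open>c * t^2\<close> never has valuation \<open>d\<close>, so the phase is
  already trivial on all of \<open>P m\<close> and only the volume remains.\<close>

lemma fresnel_odd:
  assumes c: "c \<noteq> 0" "v c + 2 * m = d + 1"
  shows "fresnel c = of_real (qr powi (- m))"
proof -
  have m: "(d - v c + 1) div 2 = m" using c by presburger
  show ?thesis
    unfolding fresnel_def m measure_P[symmetric]
    by (rule set_integral_eq_measure[of _ m]) (use c in \<open>auto intro!: quadratic_phase_trivial[of c m]\<close>)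
qed

lemma parity_cases:
  obtains m where "v c + 2 * m = d" | m where "v c + 2 * m = d + 1"
proof (cases "even (d - v c)")
  case True
  then obtain m where "d - v c = 2 * m" by blast
  then show ?thesis using that(1)[of m] by simp
next
  case False
  then obtain m where "d - v c = 2 * m + 1" by (rule oddE)
  then show ?thesis using that(2)[of "m + 1"] by simp
qed

lemma fresnel_square:
  assumes c: "c \<noteq> 0" and w: "w \<noteq> 0" "v w = 0"
  shows "fresnel (c * w\<^sup>2) = fresnel c"
proof -
  have cw: "c * w\<^sup>2 \<noteq> 0" "v (c * w\<^sup>2) = v c" using c w by (simp_all add: v_mult v_power)
  show ?thesis
  proof (cases rule: parity_cases[of c])
    case (1 m)
    have "gsum (c * (\<pi> powi m)\<^sup>2 * w\<^sup>2) = gsum (c * (\<pi> powi m)\<^sup>2)"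
      using c 1 w by (intro gsum_square) (simp_all add: v_mult v_power)
    then show ?thesis using fresnel_even[OF c 1] fresnel_even[OF cw(1), of m] cw 1 by (simp add: ac_simps)
  next
    case (2 m)
    then show ?thesis using fresnel_odd[OF c 2] fresnel_odd[OF cw(1), of m] cw by simp
  qed
qed

text \<open>Expanding the square, the cross term \<open>2 * c * x * y\<close> reaches depth
  \<open>d\<close> exactly for \<open>k = d - v c - l\<close>, while \<open>c * y^2\<close> is then
  already invisible because \<open>d - v c > 2 * l\<close>. The same inequality keeps the shell
  stable.\<close>

lemma shell_integral_low:
  assumes c: "c \<noteq> 0" "v c + 2 * l < d"
  shows "(LINT t:shell v l|\<mu>. \<psi> (c * t\<^sup>2)) = 0"
proof (rule integral_eq_0_if_oscillating[where c = "\<lambda>x. 2 * c * x" and k = "d - v c - l" and N = l and B = 1])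
  fix x y assume x: "x \<in> shell v l" and y: "y \<in> P (d - v c - l)"
  show "x + y \<in> shell v l" by (rule shell_stable[OF x]) (rule P_mono[OF y], use c in simp)
  have "y\<^sup>2 \<in> P (d + 1 - v c)" by (rule P_mono[OF P_power2[OF y]]) (use c in simp)
  then have "\<psi> (c * y\<^sup>2) = 1" using c by (intro psi_triv) (simp add: P_mult_iff)
  moreover have "c * (x + y)\<^sup>2 = c * x\<^sup>2 + 2 * c * x * y + c * y\<^sup>2" by (simp add: power2_eq_square algebra_simps)
  ultimately show "\<psi> (c * (x + y)\<^sup>2) = \<psi> (c * x\<^sup>2) * \<psi> (2 * c * x * y)" by (simp add: psi_add)
next
  fix x assume "x \<in> shell v l"
  then show "2 * c * x \<noteq> 0 \<and> v (2 * c * x) = d - (d - v c - l)" using c by (simp add: shell_def v_mult)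
next
  show "shell v l \<subseteq> P l" by (auto simp: shell_eq)
qed simp

lemma shell_integral_high:
  assumes c: "c \<noteq> 0" "d < v c + 2 * l"
  shows "(LINT t:shell v l|\<mu>. \<psi> (c * t\<^sup>2)) = of_real (qr powi (- l) - qr powi (- (l + 1)))"
  unfolding measure_shell[symmetric]
  by (rule set_integral_eq_measure[of _ l])
    (use c in \<open>auto intro!: quadratic_phase_trivial[of _ l] simp: shell_eq\<close>)

text \<open>On \<open>P (m + 1)\<close> the phase is trivial in either parity, so adding that volume
  completes the critical shell to the domain in \<open>fresnel\<close>.\<close>

lemma shell_integral_mid:
  assumes c: "c \<noteq> 0" "v c + 2 * m = d \<or> v c + 2 * m = d + 1"
  shows "(LINT t:shell v m|\<mu>. \<psi> (c * t\<^sup>2)) + of_real (qr powi (- (m + 1))) = fresnel c"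
proof -
  have m: "(d - v c + 1) div 2 = m" using c by presburger
  have int: "set_integrable \<mu> (P m) (\<lambda>t. \<psi> (c * t\<^sup>2))"
  proof (rule integrable_invariant[where k = "m + 1" and N = m and B = 1])
    fix x y assume x: "x \<in> P m" and y: "y \<in> P (m + 1)"
    show "x + y \<in> P m" using x P_mono[OF y, of m] by (simp add: P_add)
    show "\<psi> (c * (x + y)\<^sup>2) = \<psi> (c * x\<^sup>2)"
      by (rule quadratic_phase_invariant[OF c(1) _ x y]) (use c in auto)
  qed auto
  have "(LINT t:shell v m \<union> P (m + 1)|\<mu>. \<psi> (c * t\<^sup>2)) =
      (LINT t:shell v m|\<mu>. \<psi> (c * t\<^sup>2)) + (LINT t:P (m + 1)|\<mu>. \<psi> (c * t\<^sup>2))"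
    by (rule set_integral_Un; (rule set_integrable_subset[OF int])?) (auto simp: shell_eq intro: P_mono)
  also have "shell v m \<union> P (m + 1) = P m" by (auto simp: shell_eq intro: P_mono)
  also have "(LINT t:P (m + 1)|\<mu>. \<psi> (c * t\<^sup>2)) = of_real (measure \<mu> (P (m + 1)))"
    by (rule set_integral_eq_measure[of _ "m + 1"]) (use c in \<open>auto intro!: quadratic_phase_trivial[of c "m + 1"]\<close>)
  finally show ?thesis by (simp add: fresnel_def m measure_P)
qed

lemma has_sum_shells:
  assumes c: "c \<noteq> 0"
  shows "((\<lambda>l. LINT t:shell v l|\<mu>. \<psi> (c * t\<^sup>2)) has_sum fresnel c) UNIV"
proof -
  obtain m where m: "v c + 2 * m = d \<or> v c + 2 * m = d + 1" using parity_cases by metis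
  define F where "F l = (LINT t:shell v l|\<mu>. \<psi> (c * t\<^sup>2))" for l
  have "(F has_sum of_real (qr powi (- (m + 1)))) {m + 1..}"
  proof (rule has_sum_cong[THEN iffD1, rotated])
    show "((\<lambda>l. complex_of_real (qr powi (- l) - qr powi (- (l + 1)))) has_sum
        of_real (qr powi (- (m + 1)))) {m + 1..}"
      by (rule has_sum_shell_measures)
    show "of_real (qr powi (- l) - qr powi (- (l + 1))) = F l" if "l \<in> {m + 1..}" for l
      unfolding F_def by (rule shell_integral_high[symmetric]) (use c m that in auto)
  qed
  then have "(F has_sum (F m + of_real (qr powi (- (m + 1))))) (insert m {m + 1..})"
    by (intro has_sum_insert) auto
  then have "(F has_sum fresnel c) (insert m {m + 1..})"
    using shell_integral_mid[OF c m] by (simp add: F_def)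
  then have "(F has_sum fresnel c) UNIV"
  proof (rule has_sum_cong_neutral[THEN iffD1, rotated 3])
    fix l assume "l \<in> UNIV - insert m {m + 1..}"
    then have "l < m" by auto
    then show "F l = 0" unfolding F_def using m by (intro shell_integral_low[OF c]) auto
  qed auto
  then show ?thesis unfolding F_def .
qed

lemma infsum_shells:
  assumes c: "c \<noteq> 0"
  shows "(\<Sum>\<^sub>\<infinity>l. LINT t:shell v l|\<mu>. \<psi> (b + c * t\<^sup>2)) = \<psi> b * fresnel c"
proof -
  have "(LINT t:shell v l|\<mu>. \<psi> (b + c * t\<^sup>2)) = \<psi> b * (LINT t:shell v l|\<mu>. \<psi> (c * t\<^sup>2))" for l
  proof -
    have "indicat_real (shell v l) t *\<^sub>R \<psi> (b + c * t\<^sup>2) =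
        \<psi> b * (indicat_real (shell v l) t *\<^sub>R \<psi> (c * t\<^sup>2))" for t
      by (simp add: psi_add)
    then show ?thesis unfolding set_lebesgue_integral_def by (simp only: integral_mult_right_zero)
  qed
  then show ?thesis
    using has_sum_cmult_right[OF has_sum_shells[OF c], of "\<psi> b"] by (simp add: infsumI)
qed

section \<open>Stationary phase\<close>

definition kloosterman_phase :: "'k \<Rightarrow> 'k \<Rightarrow> complex" where
  "kloosterman_phase c x = \<psi> (c * (x + inverse x))"

definition norm_shell :: "int \<Rightarrow> 'k set" where
  "norm_shell n = shell v n \<inter> norm_group \<pi>"

lemma norm_shellD: "x \<in> norm_shell n \<Longrightarrow> x \<noteq> 0" "x \<in> norm_shell n \<Longrightarrow> v x = n"
  by (auto simp: norm_shell_def shell_def)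

lemma norm_shell_subset: "norm_shell n \<subseteq> P n"
  by (auto simp: norm_shell_def shell_eq)

lemma norm_shell_stable:
  assumes x: "x \<in> norm_shell n" and y: "y \<in> P k" and k: "n < k"
  shows "x + y \<in> norm_shell n"
proof -
  have "y \<in> P (n + 1)" by (rule P_mono[OF y]) (use k in simp)
  then show ?thesis
    using x shell_stable[of x n y] norm_group_stable[of x y] norm_shellD(2)[OF x] by (simp add: norm_shell_def)
qed

text \<open>First-order Taylor expansion with exact remainder:
  \<open>1/(x + y) = 1/x - y/x^2 + z\<close> with \<open>z = y^2 / (x^2 * (x + y))\<close>. Since
  \<open>z\<close> has valuation at least \<open>2 * k - 3 * n\<close>, the last assumption makes
  \<open>\<psi> (c * z)\<close> trivial.\<close>

lemma phase_shift:
  assumes c: "c \<noteq> 0" and x: "x \<noteq> 0" "v x = n" and y: "y \<in> P k"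
    and k: "n < k" "d < v c + 2 * k - 3 * n"
  shows "kloosterman_phase c (x + y) = kloosterman_phase c x * \<psi> (c * (1 - inverse (x\<^sup>2)) * y)"
proof -
  have "y \<in> P (v x + 1)" by (rule P_mono[OF y]) (use k x in simp)
  then have xy: "x + y \<noteq> 0" "v (x + y) = n" using v_add_eq x by auto
  define z where "z = y\<^sup>2 / (x\<^sup>2 * (x + y))"
  have "y\<^sup>2 \<in> P (d + 1 - v c + 3 * n)" by (rule P_mono[OF P_power2[OF y]]) (use k in simp)
  then have "z \<in> P (d + 1 - v c)" using x xy by (simp add: z_def P_divide_iff v_mult v_power)
  then have "\<psi> (c * z) = 1" using c by (intro psi_triv) (simp add: P_mult_iff)
  moreover have "c * (x + y + inverse (x + y)) = c * (x + inverse x) + c * (1 - inverse (x\<^sup>2)) * y + c * z"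
  proof -
    define w where "w = x + y"
    have w: "y = w - x" "w \<noteq> 0" using xy by (simp_all add: w_def)
    have i: "inverse (x + y) = inverse x - inverse (x\<^sup>2) * y + z"
      unfolding z_def w_def[symmetric] w(1) using x w(2) by (simp add: field_simps power2_eq_square)
    show ?thesis unfolding i by (simp add: algebra_simps)
  qed
  ultimately show ?thesis by (simp add: kloosterman_phase_def psi_add)
qed

lemma integrable_phase:
  assumes c: "c \<noteq> 0" "v c < d"
  shows "set_integrable \<mu> (norm_shell n) (kloosterman_phase c)"
\<comment> \<open>A generous level: the term \<open>4 * \<bar>n\<bar>\<close> outweighs both the
  derivative, of valuation at least \<open>- 2 * \<bar>n\<bar>\<close>, and the loss
  \<open>3 * n\<close> in the remainder.\<close>
proof (rule integrable_invariant[where k = "d + 1 - v c + 4 * \<bar>n\<bar>" and N = n and B = 1])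
  fix x y assume x: "x \<in> norm_shell n" and y: "y \<in> P (d + 1 - v c + 4 * \<bar>n\<bar>)"
  show "x + y \<in> norm_shell n" by (rule norm_shell_stable[OF x y]) (use c in simp)
  have xn: "x \<noteq> 0" "v x = n" using norm_shellD[OF x] by auto
  have "1 - inverse (x\<^sup>2) \<in> P (- 2 * \<bar>n\<bar>)"
    by (rule P_diff) (use xn P_mono[OF P_1(1), of "- 2 * \<bar>n\<bar>"] in \<open>auto simp: P_iff v_inverse v_power\<close>)
  then have "(1 - inverse (x\<^sup>2)) * y \<in> P (- 2 * \<bar>n\<bar> + (d + 1 - v c + 4 * \<bar>n\<bar>))" using y by (rule P_mult)
  then have "(1 - inverse (x\<^sup>2)) * y \<in> P (d + 1 - v c)" by (rule P_mono) simp
  then have "\<psi> (c * ((1 - inverse (x\<^sup>2)) * y)) = 1" using c by (intro psi_triv) (simp add: P_mult_iff)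
  then show "kloosterman_phase c (x + y) = kloosterman_phase c x"
    using phase_shift[OF c(1) xn y] c by (simp add: mult.assoc)
qed (auto simp: norm_shell_subset kloosterman_phase_def)

text \<open>For \<open>n > 0\<close> the term \<open>1/x^2\<close> dominates the derivative
  \<open>1 - 1/x^2\<close>, for \<open>n < 0\<close> the term 1 does. Either way its valuation is
  \<open>- 2 * max n 0\<close> on the whole shell, so there is no stationary point.\<close>

lemma phase_integral_off_center:
  assumes c: "c \<noteq> 0" "v c < d" and n: "n \<noteq> 0"
  shows "(LINT x:norm_shell n|\<mu>. kloosterman_phase c x) = 0"
proof (rule integral_eq_0_if_oscillating[where c = "\<lambda>x. c * (1 - inverse (x\<^sup>2))"
      and k = "d - v c + 2 * max n 0" and N = n and B = 1])
  fix x y assume x: "x \<in> norm_shell n" and y: "y \<in> P (d - v c + 2 * max n 0)"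
  show "x + y \<in> norm_shell n" by (rule norm_shell_stable[OF x y]) (use c in simp)
  show "kloosterman_phase c (x + y) = kloosterman_phase c x * \<psi> (c * (1 - inverse (x\<^sup>2)) * y)"
    by (rule phase_shift[OF c(1) norm_shellD[OF x] y]) (use c in auto)
next
  fix x assume x: "x \<in> norm_shell n"
  have xn: "x \<noteq> 0" "v x = n" using norm_shellD[OF x] by auto
  then have vi: "v (inverse (x\<^sup>2)) = - 2 * n" by (simp add: v_inverse v_power)
  have "1 - inverse (x\<^sup>2) \<noteq> 0 \<and> v (1 - inverse (x\<^sup>2)) = - 2 * max n 0"
  proof (cases "n > 0")
    case True
    then have "1 \<in> P (v (- inverse (x\<^sup>2)) + 1)" using vi by (simp add: P_iff)
    then show ?thesis using v_add_eq[of "- inverse (x\<^sup>2)" 1] xn vi True by simp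
  next
    case False
    then have "- inverse (x\<^sup>2) \<in> P (v 1 + 1)" using vi n xn by (simp add: P_iff)
    then show ?thesis using v_add_eq[of 1 "- inverse (x\<^sup>2)"] False by simp
  qed
  then show "c * (1 - inverse (x\<^sup>2)) \<noteq> 0 \<and>
      v (c * (1 - inverse (x\<^sup>2))) = d - (d - v c + 2 * max n 0)"
    using c by (simp add: v_mult)
qed (auto simp: norm_shell_subset kloosterman_phase_def)

text \<open>A neighbourhood of the stationary points, measured by the derivative: on units
  \<open>1 - 1/x^2\<close> and \<open>x^2 - 1\<close> have the same valuation.\<close>

definition near_square_one :: "int \<Rightarrow> 'k set" where
  "near_square_one j = {x \<in> norm_shell 0. x\<^sup>2 - 1 \<in> P j}"

lemma near_square_one_sets: "near_square_one j \<in> sets borel"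
proof (rule stable_sets[of _ "max j 1"])
  fix x y assume x: "x \<in> near_square_one j" and y: "y \<in> P (max j 1)"
  have x0: "x \<in> norm_shell 0" "x \<in> P 0" using x norm_shell_subset by (auto simp: near_square_one_def)
  have "(x + y)\<^sup>2 - x\<^sup>2 \<in> P j" using square_diff_P[OF x0(2) y] P_mono[of _ "max j 1" j] by simp
  then have "(x + y)\<^sup>2 - x\<^sup>2 + (x\<^sup>2 - 1) \<in> P j" using x by (intro P_add) (simp_all add: near_square_one_def)
  then show "x + y \<in> near_square_one j"
    using norm_shell_stable[OF x0(1) y] by (simp add: near_square_one_def)
qed

text \<open>On the removed layer the derivative has valuation exactly \<open>j\<close>, so shifts by
  \<open>P (d - v c - j)\<close> oscillate. The condition \<open>2 * j < d - v c\<close> is what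
  both the stability of the layer and the quadratic remainder need.\<close>

lemma phase_integral_step:
  assumes c: "c \<noteq> 0" "v c < d" and j: "0 \<le> j" "2 * j < d - v c"
  shows "(LINT x:near_square_one j|\<mu>. kloosterman_phase c x) =
    (LINT x:near_square_one (j + 1)|\<mu>. kloosterman_phase c x)"
proof -
  define A where "A = near_square_one j - near_square_one (j + 1)"
  have int: "set_integrable \<mu> B (kloosterman_phase c)" if "B \<subseteq> norm_shell 0" "B \<in> sets borel" for B
    by (rule set_integrable_subset[OF integrable_phase[OF c]]) (use that in auto)
  have Amem: "x \<in> A \<longleftrightarrow> x \<in> norm_shell 0 \<and> x\<^sup>2 - 1 \<noteq> 0 \<and> v (x\<^sup>2 - 1) = j" for x
    by (auto simp: A_def near_square_one_def frac_ideal_def)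
  have "(LINT x:A|\<mu>. kloosterman_phase c x) = 0"
  proof (rule integral_eq_0_if_oscillating[where c = "\<lambda>x. c * (1 - inverse (x\<^sup>2))"
        and k = "d - v c - j" and N = 0 and B = 1])
    fix x y assume x: "x \<in> A" and y: "y \<in> P (d - v c - j)"
    have x0: "x \<in> norm_shell 0" "x \<in> P 0" using x norm_shell_subset by (auto simp: Amem)
    have "(x + y)\<^sup>2 - x\<^sup>2 \<in> P (v (x\<^sup>2 - 1) + 1)"
      using P_mono[OF square_diff_P[OF x0(2) y], of "j + 1"] j x by (simp add: Amem)
    then have "(x + y)\<^sup>2 - 1 \<noteq> 0 \<and> v ((x + y)\<^sup>2 - 1) = j"
      using v_add_eq[of "x\<^sup>2 - 1" "(x + y)\<^sup>2 - x\<^sup>2"] x by (simp add: Amem)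
    then show "x + y \<in> A" using norm_shell_stable[OF x0(1) y] j by (simp add: Amem)
    show "kloosterman_phase c (x + y) = kloosterman_phase c x * \<psi> (c * (1 - inverse (x\<^sup>2)) * y)"
      by (rule phase_shift[OF c(1) norm_shellD[OF x0(1)] y]) (use j in auto)
  next
    fix x assume x: "x \<in> A"
    then have xn: "x \<noteq> 0" "v x = 0" using norm_shellD by (auto simp: Amem)
    have "1 - inverse (x\<^sup>2) = (x\<^sup>2 - 1) / x\<^sup>2" using xn by (simp add: field_simps)
    then have "1 - inverse (x\<^sup>2) \<noteq> 0 \<and> v (1 - inverse (x\<^sup>2)) = j"
      using x xn by (auto simp: Amem v_divide v_power)
    then show "c * (1 - inverse (x\<^sup>2)) \<noteq> 0 \<and> v (c * (1 - inverse (x\<^sup>2))) = d - (d - v c - j)"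
      using c by (simp add: v_mult)
  qed (use norm_shell_subset[of 0] in \<open>auto simp: Amem kloosterman_phase_def\<close>)
  moreover have "near_square_one j = A \<union> near_square_one (j + 1)"
    by (auto simp: A_def near_square_one_def intro: P_mono)
  moreover have "(LINT x:A \<union> near_square_one (j + 1)|\<mu>. kloosterman_phase c x) =
      (LINT x:A|\<mu>. kloosterman_phase c x) + (LINT x:near_square_one (j + 1)|\<mu>. kloosterman_phase c x)"
  proof (rule set_integral_Un)
    have sub: "near_square_one i \<subseteq> norm_shell 0" for i by (auto simp: near_square_one_def)
    show "A \<inter> near_square_one (j + 1) = {}" by (auto simp: A_def)
    show "set_integrable \<mu> A (kloosterman_phase c)"
      by (rule int) (use sub in \<open>auto simp: A_def near_square_one_sets\<close>)
    show "set_integrable \<mu> (near_square_one (j + 1)) (kloosterman_phase c)"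
      by (rule int[OF sub near_square_one_sets])
  qed
  ultimately show ?thesis by simp
qed

text \<open>\<open>(1 + y) + 1/(1 + y) = 2 + y^2 - y^3/(1 + y)\<close>, and the cubic term lies
  beyond the depth because \<open>d < v c + 3 * m\<close>.\<close>

lemma phase_near_one:
  assumes c: "c \<noteq> 0" "d < v c + 3 * m" and m: "1 \<le> m" and y: "y \<in> P m"
  shows "kloosterman_phase c (1 + y) = \<psi> (2 * c) * \<psi> (c * y\<^sup>2)"
proof -
  have 1: "1 + y \<noteq> 0" "v (1 + y) = 0" using v_add_eq[of 1 y] P_mono[OF y m] by auto
  have "y * y\<^sup>2 \<in> P (m + 2 * m)" using y by (intro P_mult P_power2)
  then have "y * y\<^sup>2 \<in> P (d + 1 - v c)" by (rule P_mono) (use c in simp)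
  moreover define z where "z = - (y * y\<^sup>2) / (1 + y)"
  ultimately have "z \<in> P (d + 1 - v c)" using 1 by (simp add: P_divide_iff)
  then have "\<psi> (c * z) = 1" using c by (intro psi_triv) (simp add: P_mult_iff)
  moreover have i: "1 + y + inverse (1 + y) = 2 + y\<^sup>2 + z"
    using 1 by (simp add: z_def field_simps power2_eq_square)
  ultimately show ?thesis
    unfolding kloosterman_phase_def i by (simp add: psi_add distrib_left mult.commute)
qed

lemma phase_integral_center:
  assumes c: "c \<noteq> 0" "v c < d"
  shows "(LINT x:norm_shell 0|\<mu>. kloosterman_phase c x) =
    \<psi> (2 * c) * fresnel c + (if - 1 \<in> norm_group \<pi> then \<psi> (- 2 * c) * fresnel (- c) else 0)"
proof -
  \<comment> \<open>The radius in \<open>fresnel c\<close>: layers can be removed precisely down to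
    it, and since \<open>v c < d\<close> it is also small enough for the quadratic
    approximation.\<close>
  define m where "m = (d - v c + 1) div 2"
  have m: "1 \<le> m" "d < v c + 3 * m" using c unfolding m_def by presburger+
  have int: "set_integrable \<mu> B (kloosterman_phase c)" if "B \<subseteq> norm_shell 0" "B \<in> sets borel" for B
    by (rule set_integrable_subset[OF integrable_phase[OF c]]) (use that in auto)
  have "(LINT x:near_square_one (int i)|\<mu>. kloosterman_phase c x) =
      (LINT x:near_square_one 0|\<mu>. kloosterman_phase c x)" if "int i \<le> m" for i
    using that
  proof (induction i)
    case (Suc i)
    have "2 * int i < d - v c" using Suc.prems by (simp add: m_def)
    then show ?case using phase_integral_step[OF c, of "int i"] Suc by (simp add: add.commute)
  qed simp
  from this[of "nat m"] have "(LINT x:near_square_one m|\<mu>. kloosterman_phase c x) =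
      (LINT x:near_square_one 0|\<mu>. kloosterman_phase c x)" using m by simp
  moreover have "near_square_one 0 = norm_shell 0"
  proof -
    have "x\<^sup>2 - 1 \<in> P 0" if "x \<in> norm_shell 0" for x
    proof (rule P_diff)
      have "x \<in> P 0" using that norm_shell_subset[of 0] by blast
      from P_power2[OF this] show "x\<^sup>2 \<in> P 0" by simp
    qed (rule P_1)
    then show ?thesis unfolding near_square_one_def by blast
  qed
  ultimately have eq: "(LINT x:norm_shell 0|\<mu>. kloosterman_phase c x) =
      (LINT x:near_square_one m|\<mu>. kloosterman_phase c x)" by simp
  define E1 where "E1 = {x. x - 1 \<in> P m}"
  define E2 where "E2 = {x. x + 1 \<in> P m}"
  have one: "1 \<in> norm_group \<pi>" using norm_groupI[of 1 0] by simp
  have E1: "E1 \<subseteq> norm_shell 0"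
  proof
    fix x assume "x \<in> E1"
    then have "x - 1 \<in> P m" by (simp add: E1_def)
    moreover have "1 \<in> norm_shell 0" using one by (simp add: norm_shell_def shell_def)
    ultimately show "x \<in> norm_shell 0" using norm_shell_stable[of 1 0 "x - 1" m] m by simp
  qed
  have E2: "E2 \<subseteq> norm_shell 0" if "- 1 \<in> norm_group \<pi>"
  proof
    fix x assume "x \<in> E2"
    then have "x + 1 \<in> P m" by (simp add: E2_def)
    moreover have "- 1 \<in> norm_shell 0" using that by (simp add: norm_shell_def shell_def)
    ultimately show "x \<in> norm_shell 0" using norm_shell_stable[of "- 1" 0 "x + 1" m] m by simp
  qed
  \<comment> \<open>The norm group is open, so the coset of -1 meets it only if it contains -1
    itself.\<close>
  have E2': "- 1 \<in> norm_group \<pi>" if "x \<in> norm_shell 0" "x \<in> E2" for x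
  proof -
    have "- (x + 1) \<in> P m" using that(2) by (simp only: E2_def mem_Collect_eq P_minus)
    then have "x + - (x + 1) \<in> norm_shell 0" using m by (intro norm_shell_stable[OF that(1)]) auto
    then show ?thesis by (simp add: norm_shell_def)
  qed
  have sets: "{x. x - a \<in> P m} \<in> sets borel" for a
  proof (rule stable_sets[of _ m])
    fix x y assume "x \<in> {x. x - a \<in> P m}" "y \<in> P m"
    then have "x - a + y \<in> P m" by (simp add: P_add)
    moreover have "x - a + y = x + y - a" by simp
    ultimately show "x + y \<in> {x. x - a \<in> P m}" by simp
  qed
  have sets: "E1 \<in> sets borel" "E2 \<in> sets borel"
    using sets[of 1] sets[of "- 1"] unfolding E1_def E2_def by simp_all
  \<comment> \<open>The factors \<open>x - 1\<close> and \<open>x + 1\<close> differ by the unit 2,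
    so at most one of them is a non-unit and carries the whole valuation of
    \<open>x^2 - 1\<close>.\<close>
  have near: "near_square_one m = {x \<in> norm_shell 0. x \<in> E1 \<or> x \<in> E2}"
  proof -
    have "x\<^sup>2 - 1 \<in> P m \<longleftrightarrow> x \<in> E1 \<or> x \<in> E2" if "x \<in> norm_shell 0" for x
    proof -
      have x: "x \<in> P 0" using that norm_shell_subset by auto
      have x1: "x - 1 \<in> P 0" "x + 1 \<in> P 0" using x P_1 by (simp_all add: P_add P_diff)
      have f: "x\<^sup>2 - 1 = (x - 1) * (x + 1)" by (simp add: power2_eq_square algebra_simps)
      show ?thesis
      proof (cases "x - 1 \<in> P 1")
        case True
        then have "x + 1 \<noteq> 0 \<and> v (x + 1) = 0" using v_add_eq[of 2 "x - 1"] by (simp add: algebra_simps)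
        moreover from this have "x \<notin> E2" using m by (simp add: E2_def P_iff)
        ultimately show ?thesis by (simp add: f E1_def mult.commute[of "x - 1"] P_mult_iff)
      next
        case False
        then have nz: "x - 1 \<noteq> 0" by (metis P_0)
        then have "v (x - 1) = 0" using False x1 by (simp add: P_iff)
        moreover from this have "x \<notin> E1" using m nz by (simp add: E1_def P_iff)
        ultimately show ?thesis using nz by (simp add: f E2_def P_mult_iff)
      qed
    qed
    then show ?thesis by (auto simp: near_square_one_def)
  qed
  have disj: "E1 \<inter> E2 = {}"
  proof (rule ccontr)
    assume "E1 \<inter> E2 \<noteq> {}"
    then obtain x where "x - 1 \<in> P m" "x + 1 \<in> P m" by (auto simp: E1_def E2_def)
    then have "x + 1 - (x - 1) \<in> P m" by (rule P_diff[rotated])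
    then show False using m by (simp add: P_iff)
  qed
  have meas: "(\<lambda>x. indicat_real B x *\<^sub>R kloosterman_phase c x) \<in> borel_measurable borel"
    if "B \<subseteq> norm_shell 0" "B \<in> sets borel" for B
    using borel_measurable_integrable[OF int[OF that, unfolded set_integrable_def]] by (simp only: measurable_mu)
  have F: "(LINT y:P m|\<mu>. \<psi> (2 * b) * \<psi> (b * y\<^sup>2)) = \<psi> (2 * b) * fresnel b" if "v b = v c" for b
    unfolding fresnel_def that m_def by simp
  have "(LINT x:E1|\<mu>. kloosterman_phase c x) = (LINT y:P m|\<mu>. kloosterman_phase c (1 + y))"
    using set_integral_translate[OF meas[OF E1 sets(1)], of 1] by (simp add: E1_def)
  also have "\<dots> = (LINT y:P m|\<mu>. \<psi> (2 * c) * \<psi> (c * y\<^sup>2))"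
    by (rule set_lebesgue_integral_cong) (use phase_near_one[OF c(1) m(2,1)] in auto)
  also have "\<dots> = \<psi> (2 * c) * fresnel c" by (rule F) simp
  finally have I1: "(LINT x:E1|\<mu>. kloosterman_phase c x) = \<psi> (2 * c) * fresnel c" .
  show ?thesis
  proof (cases "- 1 \<in> norm_group \<pi>")
    case False
    then have "near_square_one m = E1" using near E1 E2' by auto
    then show ?thesis using eq I1 False by simp
  next
    case True
    \<comment> \<open>\<open>x + 1/x\<close> is odd, which reduces the point -1 to the point 1 with
      \<open>c\<close> replaced by \<open>- c\<close>.\<close>
    have ph: "kloosterman_phase c (- 1 + y) = \<psi> (2 * - c) * \<psi> (- c * y\<^sup>2)" if "y \<in> P m" for y
    proof -
      have "kloosterman_phase c (- 1 + y) = kloosterman_phase (- c) (1 + - y)"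
      proof -
        have "- 1 + y = - (1 + - y)" by simp
        then have i: "inverse (- 1 + y) = - inverse (1 + - y)" by (simp only: inverse_minus_eq)
        show ?thesis unfolding kloosterman_phase_def i by (simp add: algebra_simps)
      qed
      also have "\<dots> = \<psi> (2 * - c) * \<psi> (- c * (- y)\<^sup>2)"
        by (rule phase_near_one[of _ m]) (use c m that in auto)
      finally show ?thesis by simp
    qed
    have "(LINT x:E2|\<mu>. kloosterman_phase c x) = (LINT y:P m|\<mu>. kloosterman_phase c (- 1 + y))"
      using set_integral_translate[OF meas[OF E2[OF True] sets(2)], of "- 1"] by (simp add: E2_def)
    also have "\<dots> = (LINT y:P m|\<mu>. \<psi> (2 * - c) * \<psi> (- c * y\<^sup>2))"
      by (rule set_lebesgue_integral_cong) (use ph in auto)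
    also have "\<dots> = \<psi> (2 * - c) * fresnel (- c)" by (rule F) simp
    finally have I2: "(LINT x:E2|\<mu>. kloosterman_phase c x) = \<psi> (- 2 * c) * fresnel (- c)" by simp
    have "near_square_one m = E1 \<union> E2" using near E1 E2[OF True] by auto
    moreover have "(LINT x:E1 \<union> E2|\<mu>. kloosterman_phase c x) =
        (LINT x:E1|\<mu>. kloosterman_phase c x) + (LINT x:E2|\<mu>. kloosterman_phase c x)"
      by (rule set_integral_Un[OF disj]; rule int) (use E1 E2[OF True] sets in auto)
    ultimately show ?thesis using eq I1 I2 True by simp
  qed
qed

section \<open>Assembly of the mock Fourier transform\<close>

lemma fresnel_on_norm_shell:
  assumes s: "s \<noteq> 0" and x: "x \<in> norm_shell n"
  shows "fresnel (- (s / x)) = fresnel (- (s * (- \<pi>) powi (- n)))"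
proof -
  obtain z where z: "z \<noteq> 0" "v z = 0" "x = (- \<pi>) powi n * z\<^sup>2"
    using x norm_group_iff[of x] norm_shellD(2)[OF x] by (auto simp: norm_shell_def)
  have "- (s / x) = - (s * (- \<pi>) powi (- n)) * (inverse z)\<^sup>2"
    unfolding z(3) power_int_minus by (simp add: divide_inverse power_inverse mult.assoc)
  then show ?thesis using fresnel_square[of "- (s * (- \<pi>) powi (- n))" "inverse z"] s z by (simp add: v_inverse)
qed

text \<open>On a shell the density of the multiplicative measure is the constant \<open>q^n\<close>.
  The indicator kills \<open>g\<close> off the norms, so \<open>g\<close> has to be known on
  \<open>norm_shell n\<close> only.\<close>

lemma mult_haar_integral_shell:
  fixes f g :: "'k \<Rightarrow> complex"
  assumes f: "set_integrable \<mu> (norm_shell n) f" and g: "\<And>x. x \<in> norm_shell n \<Longrightarrow> g x = K * f x"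
  shows "(LINT x:shell v n|mult_haar v \<mu>. indicator (norm_group \<pi>) x * g x) =
    of_real (qr powi n) * K * (LINT x:norm_shell n|\<mu>. f x)"
proof -
  define h where "h x = K * (indicat_real (norm_shell n) x *\<^sub>R f x)" for x
  have h: "indicat_real (shell v n) x *\<^sub>R (indicator (norm_group \<pi>) x * g x) = h x" for x
    using g[of x] by (auto simp: h_def norm_shell_def indicator_def)
  have "h \<in> borel_measurable \<mu>"
    unfolding h_def
    by (intro borel_measurable_times borel_measurable_const borel_measurable_integrable[OF f[unfolded set_integrable_def]])
  moreover have "(\<lambda>x. inverse (abs_val v x)) \<in> borel_measurable \<mu>"
    using abs_val_measurable by simp
  moreover have "AE x in \<mu>. 0 \<le> inverse (abs_val v x)" by (simp add: abs_val_def)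
  ultimately have "integral\<^sup>L (mult_haar v \<mu>) h = (LINT x|\<mu>. inverse (abs_val v x) *\<^sub>R h x)"
    unfolding mult_haar_def by (rule integral_density)
  also have "(\<lambda>x. inverse (abs_val v x) *\<^sub>R h x) =
      (\<lambda>x. (of_real (qr powi n) * K) * (indicat_real (norm_shell n) x *\<^sub>R f x))"
  proof
    fix x
    show "inverse (abs_val v x) *\<^sub>R h x =
        (of_real (qr powi n) * K) * (indicat_real (norm_shell n) x *\<^sub>R f x)"
    proof (cases "x \<in> norm_shell n")
      case True
      then have "inverse (abs_val v x) = qr powi n"
        using norm_shellD[OF True] qr_gt_1
        by (simp add: abs_val_def powr_minus powr_real_of_int' del: of_nat_power)
      then show ?thesis by (simp only: h_def scaleR_conv_of_real mult.assoc)
    qed (simp add: h_def)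
  qed
  also have "(LINT x|\<mu>. (of_real (qr powi n) * K) * (indicat_real (norm_shell n) x *\<^sub>R f x)) =
      of_real (qr powi n) * K * (LINT x:norm_shell n|\<mu>. f x)"
    unfolding set_lebesgue_integral_def by (rule integral_mult_right_zero)
  finally show ?thesis by (simp only: set_lebesgue_integral_def[of "mult_haar v \<mu>"] h)
qed

text \<open>\<open>u / (- \<pi>) powi d\<close> is a unit, and it is a square iff \<open>u\<close>
  is a norm, because \<open>- \<pi>\<close> is one. The base point is the argument occurring in
  \<open>gauss_sum\<close>.\<close>

lemma gsum_eq_quad_sgn:
  assumes u: "u \<noteq> 0" "v u = d"
  shows "gsum u = quad_sgn \<pi> u * gsum ((- \<pi>) powi d)"
proof -
  define w where "w = u / (- \<pi>) powi d"
  have uw: "u = (- \<pi>) powi d * w" by (simp add: w_def)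
  have p: "(- \<pi>) powi d \<noteq> 0" "v ((- \<pi>) powi d) = d" by (simp_all add: v_powi)
  have w: "w \<noteq> 0" "v w = 0" using u p by (simp_all add: w_def v_divide)
  show ?thesis
  proof (cases "\<exists>z. w = z\<^sup>2")
    case True
    then obtain z where z: "w = z\<^sup>2" by blast
    then have "z \<noteq> 0" "v z = 0" using w by (auto simp: v_power)
    then show ?thesis using gsum_square[OF p] norm_groupI[of z d] by (simp add: uw z quad_sgn_def)
  next
    case False
    have "u \<notin> norm_group \<pi>"
    proof
      assume "u \<in> norm_group \<pi>"
      then obtain z where "u = (- \<pi>) powi d * z\<^sup>2" using norm_group_iff u by auto
      then have "w = z\<^sup>2" by (simp add: w_def)
      then show False using False by blast
    qed
    then show ?thesis using gsum_nonsquare[OF p w False] by (simp add: uw[symmetric] quad_sgn_def)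
  qed
qed

lemma fresnel_product:
  assumes s: "s \<noteq> 0"
  shows "fresnel (- s) * fresnel (s * \<pi>) =
    of_real (qr powi (v s - d - 1)) * (quad_sgn \<pi> (- s) * gsum ((- \<pi>) powi d))"
proof -
  have q: "complex_of_real (qr powi a) * of_real (qr powi b) = of_real (qr powi (a + b))" for a b
    using qr_gt_1 by (simp add: power_int_add)
  have vs: "v (- s) = v s" "v (s * \<pi>) = v s + 1" "s * \<pi> \<noteq> 0" "- s \<noteq> 0" using s by (simp_all add: v_mult)
  show ?thesis
  proof (cases rule: parity_cases[of s])
    case (1 m)
    have sg: "quad_sgn \<pi> (- s * (\<pi> powi m)\<^sup>2) = quad_sgn \<pi> (- s)"
      using norm_group_mult_iff[of "\<pi> powi m" "- s" 0] by (simp add: quad_sgn_def)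
    have "fresnel (- s) = of_real (qr powi (- (m + 1))) * gsum (- s * (\<pi> powi m)\<^sup>2)"
      using vs 1 by (intro fresnel_even) simp_all
    moreover have "fresnel (s * \<pi>) = of_real (qr powi (- m))"
      using vs 1 by (intro fresnel_odd) simp_all
    moreover have "gsum (- s * (\<pi> powi m)\<^sup>2) = quad_sgn \<pi> (- s) * gsum ((- \<pi>) powi d)"
      unfolding sg[symmetric] by (rule gsum_eq_quad_sgn) (use s 1 in \<open>simp_all add: v_mult v_power\<close>)
    moreover have "v s - d - 1 = - (m + 1) + - m" using 1 by simp
    ultimately show ?thesis by (simp only: q[symmetric] ac_simps)
  next
    case (2 m)
    \<comment> \<open>The exponent is \<open>m - 1\<close> because
      \<open>v (s * \<pi>) + 2 * (m - 1) = d\<close>. The sign of \<open>- s\<close> reappears since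
      \<open>s * \<pi>\<close> is \<open>- s\<close> times the norm \<open>- \<pi>\<close>.\<close>
    have sg: "quad_sgn \<pi> (s * \<pi> * (\<pi> powi (m - 1))\<^sup>2) = quad_sgn \<pi> (- s)"
      using norm_group_mult_iff[of "\<pi> powi (m - 1)" "- s" 1] by (simp add: quad_sgn_def mult.assoc)
    have "fresnel (s * \<pi>) = of_real (qr powi (- (m - 1 + 1))) * gsum (s * \<pi> * (\<pi> powi (m - 1))\<^sup>2)"
      using vs 2 by (intro fresnel_even) simp_all
    moreover have "fresnel (- s) = of_real (qr powi (- m))"
      using vs 2 by (intro fresnel_odd) simp_all
    moreover have "gsum (s * \<pi> * (\<pi> powi (m - 1))\<^sup>2) = quad_sgn \<pi> (- s) * gsum ((- \<pi>) powi d)"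
      unfolding sg[symmetric] by (rule gsum_eq_quad_sgn) (use s 2 in \<open>simp_all add: v_mult v_power\<close>)
    moreover have "v s - d - 1 = - m + - (m - 1 + 1)" using 2 by simp
    ultimately show ?thesis by (simp only: q[symmetric] ac_simps)
  qed
qed

lemma mock_fourier_eq:
  assumes s: "s \<noteq> 0" "v s + 1 < d" and \<Phi>: "\<And>y. \<Phi> (\<beta> * y) = \<psi> y"
  shows "mock_fourier v \<mu> \<Phi> \<pi> \<beta> s \<pi> =
    of_real (qr powi (v s - d - 1)) * (quad_sgn \<pi> (- s) * gsum ((- \<pi>) powi d)) *
    (\<psi> (2 * (s * \<pi>)) + (if - 1 \<in> norm_group \<pi> then \<psi> (- 2 * (s * \<pi>)) else 0))"
proof -
  define c where "c = s * \<pi>"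
  have c: "c \<noteq> 0" "v c < d" using s by (simp_all add: c_def v_mult)
  define K where "K n = fresnel (- (s * (- \<pi>) powi (- n)))" for n
  define I where "I n = (LINT x:norm_shell n|\<mu>. kloosterman_phase c x)" for n
  have inner: "(\<Sum>\<^sub>\<infinity>l. LINT t:shell v l|\<mu>.
      \<Phi> (\<beta> * s * (x * \<pi> + inverse x * \<pi> - inverse x * t\<^sup>2))) = K n * kloosterman_phase c x"
    if x: "x \<in> norm_shell n" for x n
  proof -
    have "\<beta> * s * (x * \<pi> + inverse x * \<pi> - inverse x * t\<^sup>2) =
        \<beta> * (c * (x + inverse x) + - (s / x) * t\<^sup>2)" for t
      by (simp add: c_def algebra_simps divide_inverse)
    then have e: "\<Phi> (\<beta> * s * (x * \<pi> + inverse x * \<pi> - inverse x * t\<^sup>2)) =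
        \<psi> (c * (x + inverse x) + - (s / x) * t\<^sup>2)" for t
      by (simp only: \<Phi>)
    have nz: "- (s / x) \<noteq> 0" using s norm_shellD[OF x] by simp
    show ?thesis
      unfolding e by (simp only: infsum_shells[OF nz] fresnel_on_norm_shell[OF s(1) x] K_def kloosterman_phase_def mult.commute)
  qed
  have outer: "(LINT x:shell v n|mult_haar v \<mu>. indicator (norm_group \<pi>) x *
      (\<Sum>\<^sub>\<infinity>l. LINT t:shell v l|\<mu>. \<Phi> (\<beta> * s * (x * \<pi> + inverse x * \<pi> - inverse x * t\<^sup>2)))) =
      of_real (qr powi n) * K n * I n" for n
    unfolding I_def by (rule mult_haar_integral_shell[OF integrable_phase[OF c] inner])
  have "mock_fourier v \<mu> \<Phi> \<pi> \<beta> s \<pi> = (\<Sum>\<^sub>\<infinity>n. of_real (qr powi n) * K n * I n)"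
    unfolding mock_fourier_def outer ..
  also have "\<dots> = (\<Sum>\<^sub>\<infinity>n\<in>{0}. of_real (qr powi n) * K n * I n)"
    by (rule infsum_cong_neutral) (use phase_integral_off_center[OF c] in \<open>auto simp: I_def\<close>)
  also have "\<dots> = fresnel (- s) * I 0" by (simp add: K_def)
  \<comment> \<open>As a unit norm, -1 is a square, so \<open>fresnel (- c) = fresnel c\<close> and
    the factor can be taken out of both stationary terms.\<close>
  also have "I 0 = fresnel c * (\<psi> (2 * c) + (if - 1 \<in> norm_group \<pi> then \<psi> (- 2 * c) else 0))"
  proof (cases "- 1 \<in> norm_group \<pi>")
    case True
    then have "\<exists>w::'k. - 1 = w\<^sup>2" using norm_group_unit[of "- 1"] by simp
    then obtain w :: 'k where w: "- 1 = w\<^sup>2" by blast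
    have "w \<noteq> 0" using w by auto
    moreover have "v w = 0" using w \<open>w \<noteq> 0\<close> v_power[of w 2] v_minus_one by simp
    ultimately have "fresnel (c * w\<^sup>2) = fresnel c" using c by (intro fresnel_square)
    then have "fresnel (- c) = fresnel c" by (simp add: w[symmetric])
    then show ?thesis using phase_integral_center[OF c] True by (simp add: I_def algebra_simps)
  next
    case False
    then show ?thesis using phase_integral_center[OF c] by (simp add: I_def algebra_simps)
  qed
  finally show ?thesis using fresnel_product[OF s(1)] by (simp only: c_def mult.assoc[symmetric])
qed

text \<open>The pairing with the element of parameter \<open>c\<close> is
  \<open>\<psi> (2 * c * \<pi>)\<close>, surely trivial once \<open>v c \<ge> d\<close>. Depths on
  this torus are \<open>v c + 1/2\<close>, so the strict inequality \<open>> d - 1/2\<close> means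
  exactly \<open>v c \<ge> d\<close>; a point of \<open>P d\<close> where \<open>\<psi>\<close> is
  non-trivial rules out a larger value.\<close>

lemma dual_depth_eq:
  assumes \<Phi>: "\<And>y. \<Phi> (\<beta> * y) = \<psi> y"
  shows "dual_depth v \<Phi> \<pi> (trace_functional (torus_lie \<pi> \<beta>)) = 1 / 2 - real_of_int d"
proof -
  have val: "\<Phi> (trace_functional (torus_lie \<pi> \<beta>) (torus_lie \<pi> c)) = \<psi> (2 * c * \<pi>)" for c
    unfolding \<Phi>[symmetric]
    by (simp add: trace_functional_def torus_lie_eq mat2_mult mat2_trace algebra_simps)
  have depth: "lie_depth v \<pi> c = real_of_int (v c) + 1 / 2" if "c \<noteq> 0" for c
    using that by (simp add: lie_depth_def v_mult v_power add_divide_distrib)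
  show ?thesis
    unfolding dual_depth_def val
  proof (rule Greatest_equality)
    show "\<forall>c. c = 0 \<or> - (1 / 2 - real_of_int d) < lie_depth v \<pi> c \<longrightarrow> \<psi> (2 * c * \<pi>) = 1"
    proof (intro allI impI)
      fix c assume c: "c = 0 \<or> - (1 / 2 - real_of_int d) < lie_depth v \<pi> c"
      show "\<psi> (2 * c * \<pi>) = 1"
      proof (cases "c = 0")
        case False
        then have "real_of_int (d - 1) < real_of_int (v c)" using c by (simp add: depth)
        then have "d \<le> v c" by linarith
        then show ?thesis using False by (intro psi_triv) (simp add: P_iff v_mult)
      qed simp
    qed
  next
    fix \<rho> assume \<rho>: "\<forall>c. c = 0 \<or> - \<rho> < lie_depth v \<pi> c \<longrightarrow> \<psi> (2 * c * \<pi>) = 1"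
    obtain x where x: "x \<in> P d" "\<psi> x \<noteq> 1" using psi_nontriv by blast
    then have x0: "x \<noteq> 0" by auto
    define c where "c = x / (2 * \<pi>)"
    have "2 * c * \<pi> = x" by (simp add: c_def)
    then have "\<not> - \<rho> < lie_depth v \<pi> c" using \<rho> x by metis
    moreover have "c \<noteq> 0" "v c = v x - 1" using x0 by (simp_all add: c_def v_divide v_mult)
    moreover have "d \<le> v x" using x x0 by (simp add: P_iff)
    ultimately show "\<rho> \<le> 1 / 2 - real_of_int d" by (simp add: depth)
  qed
qed

lemma gauss_sum_eq:
  assumes "char_depth v \<psi> = d"
  shows "gauss_sum v \<pi> \<psi> = of_real (qr powr (- 1 / 2)) * gsum ((- \<pi>) powi d)"
  unfolding gauss_sum_def gsum_def assms
  by (simp only: sum_residue_classes[of "\<lambda>x. \<psi> ((- \<pi>) powi d * x\<^sup>2)"])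

lemma abs_val_lie_disc:
  assumes s: "s \<noteq> 0"
  shows "abs_val v (lie_disc (torus_lie \<pi> s)) powr (- 1 / 2) = qr powr (real_of_int (v s) + 1 / 2)"
proof -
  define y where "y = 2 * s"
  have y: "y \<noteq> 0" "v y = v s" using s by (simp_all add: y_def v_mult)
  have D: "lie_disc (torus_lie \<pi> s) = y\<^sup>2 * \<pi>"
    by (simp add: y_def lie_disc_def torus_lie_eq power2_eq_square)
  have "lie_disc (torus_lie \<pi> s) \<noteq> 0" "v (lie_disc (torus_lie \<pi> s)) = 2 * v s + 1"
    unfolding D using y by (simp_all add: v_mult v_power)
  then show ?thesis
    by (simp add: abs_val_def powr_powr algebra_simps)
qed

end

theorem theorem10p2:
  fixes v :: "'k::{field, complete_space} \<Rightarrow> int"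
    and \<mu> :: "'k measure"
    and \<Phi> :: "'k \<Rightarrow> complex"
    and \<pi> \<beta> s \<theta>' :: 'k
    and X :: "'k ^ 2 ^ 2 \<Rightarrow> 'k"
    and Y :: "'k ^ 2 ^ 2"
    and T :: "('k ^ 2 ^ 2) set"
    and q :: nat
    and r h :: real
  assumes "nonarch_local_field v"
    and "odd_residue_char v"
    and "q = residue_card v"
    and "uniformiser v \<pi>"
    and "haar v \<mu>"
    and "additive_character \<Phi>" and "nontrivial_character \<Phi>"
    and "\<beta> \<noteq> 0" and "X = trace_functional (torus_lie \<pi> \<beta>)"
    and "s \<noteq> 0" and "\<theta>' \<noteq> 0" and "Y = torus_lie \<theta>' s"
    and "dual_depth v \<Phi> \<pi> X + lie_depth v \<theta>' s < 0"
    and "T = torus \<pi>" and "T = torus \<theta>'"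
    and "r = - dual_depth v \<Phi> \<pi> X" and "h = r + 1 / 2"
  shows "mock_fourier v \<mu> \<Phi> \<pi> \<beta> s \<theta>' =
    complex_of_real (real q powr (- (h + 1)) * abs_val v (lie_disc Y) powr (- 1 / 2)) *
    gamma_factor v \<Phi> \<pi> \<beta> s *
    (\<Sum>\<sigma> \<in> weyl_group SL2 T. \<Phi> (coadjoint (SOME g. g \<in> \<sigma>) X Y))"
proof -
  interpret nonarch_local_field v by fact
  interpret odd_local_field_haar v \<pi> \<mu> by unfold_locales fact+
  define \<psi> where "\<psi> = twist \<Phi> \<beta>"
  define d where "d = char_depth v \<psi>"
  have \<Phi>\<psi>: "\<Phi> (\<beta> * y) = \<psi> y" for y by (simp add: \<psi>_def twist_def)
  have add: "\<Phi> (x + y) = \<Phi> x * \<Phi> y" and norm: "cmod (\<Phi> x) = 1" for x y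
    using \<open>additive_character \<Phi>\<close> by (auto simp: additive_character_def)
  obtain i where i: "\<forall>x\<in>P i. \<Phi> x = 1"
    using character_trivial_near_0[OF \<open>additive_character \<Phi>\<close>] by blast
  have triv: "\<forall>x\<in>P (i - v \<beta>). \<psi> x = 1"
    using i P_mult_iff[OF \<open>\<beta> \<noteq> 0\<close>] by (simp add: \<psi>_def twist_def)
  have nontriv: "nontrivial_character \<psi>"
  proof -
    obtain x where "\<Phi> x \<noteq> 1" using \<open>nontrivial_character \<Phi>\<close> by (auto simp: nontrivial_character_def)
    then have "\<psi> (x / \<beta>) \<noteq> 1" using \<open>\<beta> \<noteq> 0\<close> by (simp add: \<psi>_def twist_def)
    then show ?thesis by (auto simp: nontrivial_character_def)
  qed
  interpret local_field_character v \<pi> \<mu> \<psi> d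
  proof unfold_locales
    show "\<psi> (x + y) = \<psi> x * \<psi> y" "cmod (\<psi> x) = 1" for x y
      by (simp_all add: \<psi>_def twist_def distrib_left add norm)
    show "\<psi> x = 1" if "x \<in> P (d + 1)" for x
      using char_depth_works(1)[OF triv nontriv] that unfolding d_def .
    show "\<exists>x\<in>P d. \<psi> x \<noteq> 1"
      using char_depth_works(2)[OF triv nontriv] unfolding d_def .
  qed
  \<comment> \<open>The parameter of a torus is the quotient of the off-diagonal entries of any
    element with \<open>b\<close> non-zero, so equal tori have equal parameters.\<close>
  obtain a b where ab: "a\<^sup>2 - b\<^sup>2 * \<pi> = 1" "b \<noteq> 0" by (rule torus_point)
  have "mat2 a b (b * \<pi>) a \<in> torus \<theta>'"
    using torusI[OF ab(1) refl] \<open>T = torus \<pi>\<close> \<open>T = torus \<theta>'\<close> by simp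
  then have \<theta>': "\<theta>' = \<pi>" using ab(2) by (auto simp: torus_eq mat2_eq_iff)
  have dd: "dual_depth v \<Phi> \<pi> X = 1 / 2 - real_of_int d"
    unfolding \<open>X = _\<close> by (rule dual_depth_eq) (rule \<Phi>\<psi>)
  have hd: "h = real_of_int d" using \<open>h = _\<close> \<open>r = _\<close> dd by simp
  have "lie_depth v \<theta>' s = real_of_int (v s) + 1 / 2"
    using \<open>s \<noteq> 0\<close> by (simp add: \<theta>' lie_depth_def v_mult v_power add_divide_distrib)
  then have "real_of_int (v s + 1) < real_of_int d"
    using \<open>dual_depth v \<Phi> \<pi> X + lie_depth v \<theta>' s < 0\<close> dd by simp
  then have vs: "v s + 1 < d" by linarith
  \<comment> \<open>The half-integral exponents, from the odd valuation of the discriminant and from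
    the Gauss sum, cancel.\<close>
  have const: "real q powr (- (h + 1)) * abs_val v (lie_disc Y) powr (- 1 / 2) * qr powr (- 1 / 2) =
      qr powi (v s - d - 1)"
  proof -
    have "real q powr (- (h + 1)) * abs_val v (lie_disc Y) powr (- 1 / 2) * qr powr (- 1 / 2) =
        qr powr (- (real_of_int d + 1) + (real_of_int (v s) + 1 / 2) + - 1 / 2)"
      unfolding \<open>Y = _\<close> \<theta>' \<open>q = _\<close> hd abs_val_lie_disc[OF \<open>s \<noteq> 0\<close>] by (simp only: powr_add)
    also have "- (real_of_int d + 1) + (real_of_int (v s) + 1 / 2) + - 1 / 2 = real_of_int (v s - d - 1)"
      by simp
    also have "qr powr real_of_int (v s - d - 1) = qr powi (v s - d - 1)"
      using qr_gt_1 by (intro powr_real_of_int') auto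
    finally show ?thesis .
  qed
  have weyl: "(\<Sum>\<sigma> \<in> weyl_group SL2 T. \<Phi> (coadjoint (SOME g. g \<in> \<sigma>) X Y)) =
      \<psi> (2 * (s * \<pi>)) + (if - 1 \<in> norm_group \<pi> then \<psi> (- 2 * (s * \<pi>)) else 0)"
    unfolding \<open>T = torus \<pi>\<close> \<open>X = _\<close> \<open>Y = _\<close> \<theta>'
      sum_weyl_group_torus[OF two_nz pi_nz ab] \<Phi>\<psi>[symmetric] by (simp add: ac_simps)
  have "mock_fourier v \<mu> \<Phi> \<pi> \<beta> s \<theta>' = of_real (qr powi (v s - d - 1)) *
      (quad_sgn \<pi> (- s) * gsum ((- \<pi>) powi d)) *
      (\<psi> (2 * (s * \<pi>)) + (if - 1 \<in> norm_group \<pi> then \<psi> (- 2 * (s * \<pi>)) else 0))"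
    unfolding \<theta>' by (rule mock_fourier_eq[OF \<open>s \<noteq> 0\<close> vs]) (rule \<Phi>\<psi>)
  also have "of_real (qr powi (v s - d - 1)) * (quad_sgn \<pi> (- s) * gsum ((- \<pi>) powi d)) =
      complex_of_real (real q powr (- (h + 1)) * abs_val v (lie_disc Y) powr (- 1 / 2)) *
      gamma_factor v \<Phi> \<pi> \<beta> s"
    unfolding const[symmetric] gamma_factor_def \<psi>_def[symmetric] gauss_sum_eq[OF d_def[symmetric]]
    by (simp only: of_real_mult ac_simps)
  finally show ?thesis unfolding weyl .
qed

end
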